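(* Let $(R,\mathfrak m,k)$ be a Noetherian local ring which is a homomorphic image of a Cohen–Macaulay local ring, and let $M$ be a finitely generated $R$-module of dimension $d>0$. If $\underline{x}=x_1,\dots,x_d$ and $\underline{y}=y_1,\dots,y_d$ are two $C$-systems of parameters of $M$, then $\mathrm{ir}_M(\underline{x})=\mathrm{ir}_M(\underline{y})$. That is, the index of reducibility $\mathrm{ir}_M(\underline{x})$ of the ideal $(\underline{x})$ on $M$ does not depend on the choice of the $C$-system of parameters $\underline{x}$.
   Context: For a finitely generated $R$-module $N$ and an ideal $\mathfrak q$ generated by a system of parameters of $N$, the index of reducibility $\mathrm{ir}_N(\mathfrak q)$ is the number of irreducible components in an irredundant irreducible decomposition of the submodule $\mathfrak qN$ of $N$; equivalently $\mathrm{ir}_N(\mathfrak q)=\dim_k \mathrm{Soc}(N/\mathfrak q N)$, where $\mathrm{Soc}(L)=0:_L\mathfrak m$. For a system of parameters $\underline{x}$ we write $\mathrm{ir}_N(\underline{x})=\mathrm{ir}_N((\underline{x}))$. For a finitely generated $R$-module $N$ of dimension $s>0$, define $\mathfrak b(N)=\bigcap \mathrm{Ann}_R\big(0:_{N/(z_1,\dots,z_{i-1})N} z_i\big)$, the intersection taken over all systems of parameters $z_1,\dots,z_s$ of $N$ and all $i=1,\dots,s$. A system of parameters $x_1,\dots,x_d$ of $M$ is a $C$-system of parameters of $M$ if $x_d\in\mathfrak b(M)^3$ and $x_i\in\mathfrak b(M/(x_{i+1},\dots,x_d)M)^3$ for all $i=d-1,\dots,1$. *)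

theory Defs
  imports Main "HOL-Library.Extended_Nat"
begin

definition is_ideal :: "'a::comm_ring_1 set \<Rightarrow> bool" where
  "is_ideal I \<longleftrightarrow> 0 \<in> I \<and> (\<forall>x\<in>I. \<forall>y\<in>I. x + y \<in> I) \<and> (\<forall>r. \<forall>x\<in>I. r * x \<in> I)"

definition ideal_gen :: "'a::comm_ring_1 set \<Rightarrow> 'a set" where
  "ideal_gen X = \<Inter>{I. is_ideal I \<and> X \<subseteq> I}"

definition ideal_prod :: "'a::comm_ring_1 set \<Rightarrow> 'a set \<Rightarrow> 'a set" where
  "ideal_prod I J = ideal_gen {a * b | a b. a \<in> I \<and> b \<in> J}"

fun ideal_pow :: "'a::comm_ring_1 set \<Rightarrow> nat \<Rightarrow> 'a set" where
  "ideal_pow I 0 = UNIV"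
| "ideal_pow I (Suc n) = ideal_prod I (ideal_pow I n)"

definition prime_ideal :: "'a::comm_ring_1 set \<Rightarrow> bool" where
  "prime_ideal P \<longleftrightarrow> is_ideal P \<and> P \<noteq> UNIV \<and> (\<forall>a b. a * b \<in> P \<longrightarrow> a \<in> P \<or> b \<in> P)"

definition maximal_ideal :: "'a::comm_ring_1 set \<Rightarrow> bool" where
  "maximal_ideal m \<longleftrightarrow> is_ideal m \<and> m \<noteq> UNIV \<and>
     (\<forall>J. is_ideal J \<and> m \<subseteq> J \<longrightarrow> J = m \<or> J = UNIV)"

definition noetherian_ring :: "'a::comm_ring_1 itself \<Rightarrow> bool" where
  "noetherian_ring _ \<longleftrightarrow> (\<forall>I::'a set. is_ideal I \<longrightarrow> (\<exists>X. finite X \<and> I = ideal_gen X))"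

definition noetherian_local_ring :: "'a::comm_ring_1 itself \<Rightarrow> bool" where
  "noetherian_local_ring T \<longleftrightarrow> noetherian_ring T \<and> (\<exists>!m::'a set. maximal_ideal m)"

definition max_ideal :: "'a::comm_ring_1 set" where
  "max_ideal = (THE m. maximal_ideal m)"

definition krull_dim :: "'a::comm_ring_1 set \<Rightarrow> enat" where
  "krull_dim I = Sup {enat n | n. \<exists>P::nat \<Rightarrow> 'a set.
       (\<forall>i\<le>n. prime_ideal (P i) \<and> I \<subseteq> P i) \<and> (\<forall>i<n. P i \<subset> P (Suc i))}"

definition regular_seq :: "'a::comm_ring_1 list \<Rightarrow> bool" where
  "regular_seq ys \<longleftrightarrow> set ys \<subseteq> max_ideal \<and> ideal_gen (set ys) \<noteq> UNIV \<and>
     (\<forall>i < length ys. \<forall>a. ys ! i * a \<in> ideal_gen (set (take i ys)) \<longrightarrow> a \<in> ideal_gen (set (take i ys)))"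

definition depth :: "'a::comm_ring_1 itself \<Rightarrow> enat" where
  "depth _ = Sup {enat (length ys) | ys::'a list. regular_seq ys}"

definition cohen_macaulay_local_ring :: "'a::comm_ring_1 itself \<Rightarrow> bool" where
  "cohen_macaulay_local_ring T \<longleftrightarrow> noetherian_local_ring T \<and> depth T = krull_dim ({0}::'a set)"

definition ring_hom :: "('b::comm_ring_1 \<Rightarrow> 'a::comm_ring_1) \<Rightarrow> bool" where
  "ring_hom h \<longleftrightarrow> h 1 = 1 \<and> (\<forall>a b. h (a + b) = h a + h b) \<and> (\<forall>a b. h (a * b) = h a * h b)"

section \<open>Modules: s is the scalar multiplication, M is the whole type 'm.
  A subquotient N = L/K of M is encoded by a pair of submodules K \<subseteq> L.\<close>

definition submod :: "('a::comm_ring_1 \<Rightarrow> 'm::ab_group_add \<Rightarrow> 'm) \<Rightarrow> 'm set \<Rightarrow> bool" where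
  "submod s X \<longleftrightarrow> 0 \<in> X \<and> (\<forall>x\<in>X. \<forall>y\<in>X. x + y \<in> X) \<and> (\<forall>r. \<forall>x\<in>X. s r x \<in> X)"

definition submod_gen :: "('a::comm_ring_1 \<Rightarrow> 'm::ab_group_add \<Rightarrow> 'm) \<Rightarrow> 'm set \<Rightarrow> 'm set" where
  "submod_gen s Y = \<Inter>{N. submod s N \<and> Y \<subseteq> N}"

definition finitely_generated :: "('a::comm_ring_1 \<Rightarrow> 'm::ab_group_add \<Rightarrow> 'm) \<Rightarrow> bool" where
  "finitely_generated s \<longleftrightarrow> (\<exists>F. finite F \<and> submod_gen s F = UNIV)"

definition ideal_times :: "('a::comm_ring_1 \<Rightarrow> 'm::ab_group_add \<Rightarrow> 'm) \<Rightarrow> 'a set \<Rightarrow> 'm set \<Rightarrow> 'm set" where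
  "ideal_times s I L = submod_gen s {s a x | a x. a \<in> I \<and> x \<in> L}"

definition msum :: "'m::ab_group_add set \<Rightarrow> 'm set \<Rightarrow> 'm set" where
  "msum A B = {a + b | a b. a \<in> A \<and> b \<in> B}"

text \<open>For N = L/K and a list zs of ring elements, N/(zs)N = L/(K + (zs)L): new bottom submodule.\<close>
definition quot_bot :: "('a::comm_ring_1 \<Rightarrow> 'm::ab_group_add \<Rightarrow> 'm) \<Rightarrow> 'a list \<Rightarrow> 'm set \<Rightarrow> 'm set \<Rightarrow> 'm set" where
  "quot_bot s zs L K = msum K (ideal_times s (ideal_gen (set zs)) L)"

definition ann :: "('a::comm_ring_1 \<Rightarrow> 'm::ab_group_add \<Rightarrow> 'm) \<Rightarrow> 'm set \<Rightarrow> 'm set \<Rightarrow> 'a set" where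
  "ann s L K = {r. \<forall>x\<in>L. s r x \<in> K}"

definition mdim :: "('a::comm_ring_1 \<Rightarrow> 'm::ab_group_add \<Rightarrow> 'm) \<Rightarrow> 'm set \<Rightarrow> 'm set \<Rightarrow> enat" where
  "mdim s L K = krull_dim (ann s L K)"

definition mlength :: "('a::comm_ring_1 \<Rightarrow> 'm::ab_group_add \<Rightarrow> 'm) \<Rightarrow> 'm set \<Rightarrow> 'm set \<Rightarrow> enat" where
  "mlength s L K = Sup {enat n | n. \<exists>N::nat \<Rightarrow> 'm set. N 0 = K \<and> N n = L \<and>
       (\<forall>i\<le>n. submod s (N i)) \<and> (\<forall>i<n. N i \<subset> N (Suc i))}"

definition sop :: "('a::comm_ring_1 \<Rightarrow> 'm::ab_group_add \<Rightarrow> 'm) \<Rightarrow> 'm set \<Rightarrow> 'm set \<Rightarrow> 'a list \<Rightarrow> bool" where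
  "sop s L K zs \<longleftrightarrow> mdim s L K = enat (length zs) \<and> set zs \<subseteq> max_ideal \<and>
      mlength s L (quot_bot s zs L K) < \<infinity>"

text \<open>0 :_{L/K} z, as the submodule of L containing K.\<close>
definition colon :: "('a::comm_ring_1 \<Rightarrow> 'm::ab_group_add \<Rightarrow> 'm) \<Rightarrow> 'm set \<Rightarrow> 'm set \<Rightarrow> 'a \<Rightarrow> 'm set" where
  "colon s L K z = {x \<in> L. s z x \<in> K}"

text \<open>b(N) for N = L/K (indices 0-based: zs!i is z_{i+1}, take i zs is z_1..z_i).\<close>
definition bideal :: "('a::comm_ring_1 \<Rightarrow> 'm::ab_group_add \<Rightarrow> 'm) \<Rightarrow> 'm set \<Rightarrow> 'm set \<Rightarrow> 'a set" where
  "bideal s L K = \<Inter>{ann s (colon s L (quot_bot s (take i zs) L K) (zs ! i)) (quot_bot s (take i zs) L K)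
                    | zs i. sop s L K zs \<and> i < length zs}"

text \<open>C-system of parameters of M (= UNIV/{0}); 0-based: xs!j is x_{j+1}, drop (j+1) xs is x_{j+2},...,x_d.\<close>
definition C_sop :: "('a::comm_ring_1 \<Rightarrow> 'm::ab_group_add \<Rightarrow> 'm) \<Rightarrow> 'a list \<Rightarrow> bool" where
  "C_sop s xs \<longleftrightarrow> sop s UNIV {0} xs \<and>
     (\<forall>j < length xs. xs ! j \<in> ideal_pow (bideal s UNIV (quot_bot s (drop (Suc j) xs) UNIV {0})) 3)"

definition socle :: "('a::comm_ring_1 \<Rightarrow> 'm::ab_group_add \<Rightarrow> 'm) \<Rightarrow> 'm set \<Rightarrow> 'm set \<Rightarrow> 'm set" where
  "socle s L K = {x \<in> L. \<forall>r \<in> max_ideal. s r x \<in> K}"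

text \<open>B (a finite subset of V \<supseteq> K, V killed by m modulo K) gives a k-basis of V/K.\<close>
definition k_basis :: "('a::comm_ring_1 \<Rightarrow> 'm::ab_group_add \<Rightarrow> 'm) \<Rightarrow> 'm set \<Rightarrow> 'm set \<Rightarrow> 'm set \<Rightarrow> bool" where
  "k_basis s V K B \<longleftrightarrow> finite B \<and> B \<subseteq> V \<and>
     (\<forall>v\<in>V. \<exists>f. v - (\<Sum>b\<in>B. s (f b) b) \<in> K) \<and>
     (\<forall>f. (\<Sum>b\<in>B. s (f b) b) \<in> K \<longrightarrow> (\<forall>b\<in>B. f b \<in> max_ideal))"

definition k_dim :: "('a::comm_ring_1 \<Rightarrow> 'm::ab_group_add \<Rightarrow> 'm) \<Rightarrow> 'm set \<Rightarrow> 'm set \<Rightarrow> nat" where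
  "k_dim s V K = (LEAST n. \<exists>B. k_basis s V K B \<and> card B = n)"

definition ir :: "('a::comm_ring_1 \<Rightarrow> 'm::ab_group_add \<Rightarrow> 'm) \<Rightarrow> 'a list \<Rightarrow> nat" where
  "ir s xs = k_dim s (socle s UNIV (quot_bot s xs UNIV {0})) (quot_bot s xs UNIV {0})"

end

theory Submission
  imports Defs
begin

text \<open>If \<open>z, x, x'\<close> and \<open>z, y, x'\<close> are systems of parameters of \<open>M\<close> (\<open>z\<close> and \<open>x'\<close> sequences)
  and \<open>x, y \<in> \<mm> \<bb>(M/x'M)\<close>, both have the same index of reducibility. Indeed \<open>N = M/(z, x')M\<close> has
  dimension one, and \<open>\<bb>(M/x'M)\<close> kills the finite length submodule of \<open>N\<close>, because that submodule is
  the annihilator of a power of \<open>x y\<close> in \<open>N\<close>, which completes \<open>z\<close> to a system of parameters of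
  \<open>M/x'M\<close>; so the socles of \<open>N/xN\<close> and \<open>N/yN\<close> can be compared directly. No condition on \<open>z\<close> is
  involved, so a C-system may be altered from its first entry on. By prime avoidance the two given
  C-systems are altered to the same sequence: \<open>\<bb>(M/(x\<^sub>i\<^sub>+\<^sub>1, \<dots>, x\<^sub>d)M)\<close> contains
  \<open>x\<^sub>i, \<dots>, x\<^sub>d\<close>, hence no non-maximal prime of the support containing \<open>z\<^sub>1, \<dots>, z\<^sub>i\<^sub>-\<^sub>1\<close>
  contains it, and likewise for \<open>y\<close>; this leaves room for a common \<open>z\<^sub>i\<close>.\<close>

section \<open>Ideals and Noetherian modules\<close>

text \<open>Two parameters \<open>x\<close> and \<open>y\<close> are compared through
  \<open>x * y\<close>: multiplication by \<open>y\<close> relates the quotient by \<open>x\<close>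
  to the quotient by \<open>x * y\<close>, while no natural map relates \<open>x\<close> to
  \<open>y\<close> directly. In \<open>x = \<Sum> u w\<close> the factors do different work. A socle
  element is controlled only under multiplication by elements of the maximal ideal, hence
  \<open>u\<close>; the factor \<open>w\<close> from the \<open>bideal\<close> upgrades congruences
  modulo the finite length part to honest ones. The cube in the notion of C-system enters through
  such products. Quotients and localisations never occur as modules of their own: a quotient is a
  congruence modulo a submodule of \<open>M\<close>, and a localisation is replaced by clearing
  denominators outside a prime. Finite length is traded for a condition on the primes of the
  support, because that is the language of prime avoidance and of the principal ideal theorem, which
  governs how chains of primes shrink when a parameter is adjoined.\<close>

lemma module_mult: "module ((*) :: 'a::comm_ring_1 \<Rightarrow> 'a \<Rightarrow> 'a)"
  by unfold_locales (simp_all add: algebra_simps)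

lemma is_ideal_iff_subspace: "is_ideal I \<longleftrightarrow> module.subspace (*) I"
  by (simp add: is_ideal_def module.subspace_def[OF module_mult])

lemma ideal_gen_eq_span: "ideal_gen X = module.span (*) X"
  by (auto simp: ideal_gen_def module.span_def[OF module_mult] hull_def is_ideal_iff_subspace)

lemma is_ideal_zero: "is_ideal I \<Longrightarrow> 0 \<in> I"
  and is_ideal_add: "is_ideal I \<Longrightarrow> x \<in> I \<Longrightarrow> y \<in> I \<Longrightarrow> x + y \<in> I"
  and is_ideal_mult: "is_ideal I \<Longrightarrow> x \<in> I \<Longrightarrow> r * x \<in> I"
  and is_ideal_mult_right: "is_ideal I \<Longrightarrow> x \<in> I \<Longrightarrow> x * r \<in> I"
  by (auto simp: is_ideal_def mult.commute)

lemma is_ideal_diff: "is_ideal I \<Longrightarrow> x \<in> I \<Longrightarrow> y \<in> I \<Longrightarrow> x - y \<in> I"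
  using is_ideal_add[of I x "- y"] is_ideal_mult[of I y "- 1"] by simp

lemma is_ideal_add_cancel: "is_ideal I \<Longrightarrow> x \<in> I \<Longrightarrow> x + y \<in> I \<longleftrightarrow> y \<in> I"
  using is_ideal_add[of I x y] is_ideal_diff[of I "x + y" x] by auto

lemma is_ideal_Inter: "(\<And>I. I \<in> \<I> \<Longrightarrow> is_ideal I) \<Longrightarrow> is_ideal (\<Inter>\<I>)"
  by (auto simp: is_ideal_def)

lemma is_ideal_Int: "is_ideal I \<Longrightarrow> is_ideal J \<Longrightarrow> is_ideal (I \<inter> J)"
  by (auto simp: is_ideal_def)

lemma is_ideal_ideal_gen: "is_ideal (ideal_gen X)"
  by (simp add: is_ideal_iff_subspace ideal_gen_eq_span module.subspace_span[OF module_mult])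

lemma ideal_gen_superset: "X \<subseteq> ideal_gen X"
  by (auto simp: ideal_gen_def)

lemma ideal_gen_least: "is_ideal I \<Longrightarrow> X \<subseteq> I \<Longrightarrow> ideal_gen X \<subseteq> I"
  by (auto simp: ideal_gen_def)

lemma is_ideal_add_principal:
  assumes "is_ideal I"
  shows "is_ideal {a + x * r |a r. a \<in> I}"
  unfolding is_ideal_def
proof (intro conjI ballI allI)
  show "0 \<in> {a + x * r |a r. a \<in> I}"
    using is_ideal_zero[OF assms] by (force intro: exI[of _ 0])
next
  fix u v assume "u \<in> {a + x * r |a r. a \<in> I}" "v \<in> {a + x * r |a r. a \<in> I}"
  then obtain a b r t where "a \<in> I" "b \<in> I" "u = a + x * r" "v = b + x * t" by blast
  then have "a + b \<in> I" "u + v = (a + b) + x * (r + t)"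
    using is_ideal_add[OF assms] by (auto simp: algebra_simps)
  then show "u + v \<in> {a + x * r |a r. a \<in> I}" by blast
next
  fix c u assume "u \<in> {a + x * r |a r. a \<in> I}"
  then obtain a r where "a \<in> I" "u = a + x * r" by blast
  then have "c * a \<in> I" "c * u = c * a + x * (c * r)"
    using is_ideal_mult[OF assms] by (auto simp: algebra_simps)
  then show "c * u \<in> {a + x * r |a r. a \<in> I}" by blast
qed

lemma prime_ideal_is_ideal: "prime_ideal p \<Longrightarrow> is_ideal p"
  by (simp add: prime_ideal_def)

lemma prime_ideal_mult_iff: "prime_ideal p \<Longrightarrow> a * b \<in> p \<longleftrightarrow> a \<in> p \<or> b \<in> p"
  using is_ideal_mult is_ideal_mult_right by (fastforce simp: prime_ideal_def)

lemma prime_ideal_one: "prime_ideal p \<Longrightarrow> 1 \<notin> p"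
  using is_ideal_mult[of p 1] by (auto simp: prime_ideal_def)

lemma prime_ideal_power: "prime_ideal p \<Longrightarrow> x ^ n \<in> p \<Longrightarrow> x \<in> p"
  by (induction n) (auto simp: prime_ideal_one prime_ideal_mult_iff)

lemma prime_ideal_Int_subset:
  assumes "prime_ideal p" "is_ideal I" "is_ideal J" "I \<inter> J \<subseteq> p"
  shows "I \<subseteq> p \<or> J \<subseteq> p"
proof (rule ccontr)
  assume "\<not> ?thesis"
  then obtain a b where "a \<in> I" "a \<notin> p" "b \<in> J" "b \<notin> p" by blast
  moreover from this have "a * b \<in> p"
    using assms by (metis IntI is_ideal_mult is_ideal_mult_right subsetD)
  ultimately show False using assms(1) by (simp add: prime_ideal_mult_iff)
qed

lemma prime_ideal_ideal_prod_subset: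
  assumes "prime_ideal p" "ideal_prod I J \<subseteq> p"
  shows "I \<subseteq> p \<or> J \<subseteq> p"
proof (rule ccontr)
  assume "\<not> ?thesis"
  then obtain a b where ab: "a \<in> I" "a \<notin> p" "b \<in> J" "b \<notin> p" by blast
  then have "a * b \<in> ideal_prod I J"
    unfolding ideal_prod_def by (intro subsetD[OF ideal_gen_superset]) blast
  then show False using assms ab by (auto simp: prime_ideal_mult_iff)
qed

text \<open>Induction on the number of primes. A prime contained in another one may be dropped.
  Otherwise, if an element \<open>z\<close> avoiding all primes but \<open>p\<close> lies in
  \<open>p\<close>, it is corrected by \<open>c * b\<close> with \<open>b\<close> in
  \<open>B\<close> outside \<open>p\<close>, and \<open>c\<close> outside \<open>p\<close> but in
  all the other primes; incomparability provides the factors of \<open>c\<close>.\<close>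

lemma prime_avoidance:
  assumes "finite S" "is_ideal B" "\<And>p. p \<in> S \<Longrightarrow> prime_ideal p \<and> \<not> B \<subseteq> p"
  shows "\<exists>z\<in>B. \<forall>p\<in>S. z \<notin> p"
  using assms(1,3)
proof (induction "card S" arbitrary: S)
  case 0
  then show ?case using is_ideal_zero[OF assms(2)] by auto
next
  case (Suc n)
  show ?case
  proof (cases "\<exists>p\<in>S. \<exists>q\<in>S. p \<noteq> q \<and> p \<subseteq> q")
    case True
    then obtain p q where pq: "p \<in> S" "q \<in> S" "p \<noteq> q" "p \<subseteq> q" by blast
    have "\<exists>z\<in>B. \<forall>r\<in>S - {p}. z \<notin> r"
      using Suc pq by (intro Suc.hyps(1)) auto
    with pq show ?thesis by blast
  next
    case False
    obtain p where p: "p \<in> S" using Suc by (metis card_gt_0_iff ex_in_conv zero_less_Suc)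
    have "\<exists>z\<in>B. \<forall>r\<in>S - {p}. z \<notin> r"
      using Suc p by (intro Suc.hyps(1)) auto
    then obtain z where z: "z \<in> B" "\<forall>r\<in>S - {p}. z \<notin> r" by blast
    show ?thesis
    proof (cases "z \<in> p")
      case False
      with z show ?thesis by blast
    next
      case zp: True
      have pp: "prime_ideal p" and Bp: "\<not> B \<subseteq> p" using Suc p by auto
      then obtain b where b: "b \<in> B" "b \<notin> p" by blast
      have ideals: "is_ideal r" if "r \<in> S" for r
        using that Suc.prems by (simp add: prime_ideal_is_ideal)
      have "\<exists>c. c \<notin> p \<and> (\<forall>r\<in>T. c \<in> r)" if "finite T" "T \<subseteq> S - {p}" for T
        using that
      proof (induction T rule: finite_induct)
        case empty
        then show ?case using prime_ideal_one[OF pp] by auto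
      next
        case (insert r T)
        then obtain c where c: "c \<notin> p" "\<forall>q\<in>T. c \<in> q" by auto
        have "\<not> r \<subseteq> p" using insert.prems False p by blast
        then obtain e where e: "e \<in> r" "e \<notin> p" by blast
        have "c * e \<notin> p" using c e pp by (simp add: prime_ideal_mult_iff)
        moreover have "\<forall>q\<in>insert r T. c * e \<in> q"
          using c e ideals insert.prems by (auto intro: is_ideal_mult is_ideal_mult_right)
        ultimately show ?case by blast
      qed
      from this[of "S - {p}"] obtain c where c: "c \<notin> p" "\<forall>r\<in>S - {p}. c \<in> r"
        using Suc by auto
      have "z + c * b \<in> B" using z b assms(2) by (auto intro: is_ideal_add is_ideal_mult)
      moreover have "z + c * b \<notin> p"
        using zp b c pp prime_ideal_is_ideal[OF pp] by (simp add: is_ideal_add_cancel prime_ideal_mult_iff)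
      moreover have "z + c * b \<notin> r" if "r \<in> S - {p}" for r
      proof
        assume *: "z + c * b \<in> r"
        have "is_ideal r" using Suc that by (auto simp: prime_ideal_is_ideal)
        moreover from this have "c * b \<in> r" using c that by (auto intro: is_ideal_mult_right)
        ultimately have "z \<in> r" using * is_ideal_diff[of r "z + c * b" "c * b"] by simp
        with z that show False by blast
      qed
      ultimately show ?thesis by blast
    qed
  qed
qed

section \<open>Nakayama's lemma, finite generation, and finitely many primes over an ideal\<close>

context module
begin

lemma submod_eq_subspace: "submod scale = subspace"
  by (simp add: fun_eq_iff submod_def subspace_def)

lemma submod_gen_eq_span: "submod_gen scale = span"
  by (auto simp: fun_eq_iff submod_gen_def span_def hull_def submod_eq_subspace)

text \<open>A denominator-free form of Nakayama's lemma over the localisation at \<open>p\<close>; eliminating one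
  generator at a time avoids the determinant trick.\<close>

lemma nakayama_at_prime:
  assumes p: "prime_ideal p" and K: "subspace K" and "finite G"
    and "\<And>g. g \<in> G \<Longrightarrow> \<exists>r c. r \<notin> p \<and> (\<forall>h\<in>G. c h \<in> p) \<and> r *s g - (\<Sum>h\<in>G. c h *s h) \<in> K"
  shows "\<exists>t. t \<notin> p \<and> (\<forall>g\<in>G. t *s g \<in> K)"
  using assms(3,4)
proof (induction G rule: finite_induct)
  case empty
  then show ?case using prime_ideal_one[OF p] by auto
next
  case (insert g G)
  have pI: "is_ideal p" by (rule prime_ideal_is_ideal[OF p])
  obtain r c where r: "r \<notin> p" and c: "\<forall>h\<in>insert g G. c h \<in> p"
    and rc: "r *s g - (\<Sum>h\<in>insert g G. c h *s h) \<in> K"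
    using insert.prems by blast
  \<comment> \<open>Since \<open>c g\<close> lies in \<open>p\<close>, the total coefficient of
    \<open>g\<close> in its own relation stays outside \<open>p\<close>, so this relation solves for
    \<open>g\<close> locally at \<open>p\<close>.\<close>
  define \<sigma> where "\<sigma> = r - c g"
  have \<sigma>: "\<sigma> \<notin> p" using r c is_ideal_add[OF pI, of \<sigma> "c g"] by (auto simp: \<sigma>_def)
  have g: "\<sigma> *s g - (\<Sum>h\<in>G. c h *s h) \<in> K"
    using rc insert.hyps by (simp add: \<sigma>_def algebra_simps)
  have "\<exists>t. t \<notin> p \<and> (\<forall>h\<in>G. t *s h \<in> K)"
  proof (rule insert.IH)
    fix h assume "h \<in> G"
    then obtain r' c' where r': "r' \<notin> p" and c': "\<forall>k\<in>insert g G. c' k \<in> p"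
      and rc': "r' *s h - (\<Sum>k\<in>insert g G. c' k *s k) \<in> K"
      using insert.prems by blast
    \<comment> \<open>The relation of \<open>h\<close> scaled by \<open>\<sigma>\<close>, plus
      \<open>c' g\<close> times the relation of \<open>g\<close>: the terms in \<open>g\<close>
      cancel.\<close>
    have "\<sigma> *s (r' *s h - (\<Sum>k\<in>insert g G. c' k *s k)) + c' g *s (\<sigma> *s g - (\<Sum>h\<in>G. c h *s h)) \<in> K"
      using rc' g K by (intro subspace_add subspace_scale)
    also have "\<sigma> *s (r' *s h - (\<Sum>k\<in>insert g G. c' k *s k)) + c' g *s (\<sigma> *s g - (\<Sum>h\<in>G. c h *s h))
        = (\<sigma> * r') *s h - (\<Sum>k\<in>G. (\<sigma> * c' k + c' g * c k) *s k)"
      using insert.hyps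
      by (simp add: scale_right_diff_distrib scale_right_distrib scale_sum_right scale_left_distrib
          sum.distrib mult.commute)
    finally have "(\<sigma> * r') *s h - (\<Sum>k\<in>G. (\<sigma> * c' k + c' g * c k) *s k) \<in> K" .
    moreover have "\<sigma> * r' \<notin> p" using \<sigma> r' p by (simp add: prime_ideal_mult_iff)
    moreover have "\<forall>k\<in>G. \<sigma> * c' k + c' g * c k \<in> p"
      using c c' pI by (auto intro!: is_ideal_add is_ideal_mult)
    ultimately show "\<exists>r c. r \<notin> p \<and> (\<forall>k\<in>G. c k \<in> p) \<and> r *s h - (\<Sum>k\<in>G. c k *s k) \<in> K"
      by (intro exI[of _ "\<sigma> * r'"] exI[of _ "\<lambda>k. \<sigma> * c' k + c' g * c k"] conjI)
  qed
  then obtain t where t: "t \<notin> p" "\<forall>h\<in>G. t *s h \<in> K" by blast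
  have "c h *s (t *s h) \<in> K" if "h \<in> G" for h
    using t that by (blast intro: subspace_scale[OF K])
  then have "t *s (\<sigma> *s g - (\<Sum>h\<in>G. c h *s h)) + (\<Sum>h\<in>G. c h *s (t *s h)) \<in> K"
    using g by (simp only: subspace_add[OF K] subspace_scale[OF K] subspace_sum[OF K])
  then have "(t * \<sigma>) *s g \<in> K"
    by (simp add: scale_right_diff_distrib scale_sum_right mult.commute)
  moreover have "(t * \<sigma>) *s h \<in> K" if "h \<in> G" for h
    using subspace_scale[OF K, of "t *s h" \<sigma>] t that by (simp add: mult.commute)
  moreover have "t * \<sigma> \<notin> p" using t \<sigma> p by (simp add: prime_ideal_mult_iff)
  ultimately show ?case by blast
qed

text \<open>Induction on the generators. The coefficients of \<open>f\<close> that occur in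
  \<open>N\<close> modulo the span of \<open>F\<close> form an ideal \<open>J\<close>. Lifts to
  \<open>N\<close> of finitely many generators of \<open>J\<close>, together with generators of
  \<open>N \<inter> span F\<close>, generate \<open>N\<close>.\<close>

lemma fg_submodule:
  assumes noeth: "noetherian_ring TYPE('a)" and "finite F" "subspace N" "N \<subseteq> span F"
  shows "\<exists>G. finite G \<and> N = span G"
  using assms(2-)
proof (induction F arbitrary: N rule: finite_induct)
  case empty
  then have "N = {0}" using subspace_0 by fastforce
  then show ?case by (intro exI[of _ "{}"]) simp
next
  case (insert f F)
  define J where "J = {r. \<exists>x\<in>N. x - r *s f \<in> span F}"
  have "is_ideal J"
    unfolding is_ideal_def
  proof (intro conjI ballI allI)
    show "0 \<in> J" using subspace_0[OF insert.prems(1)] span_zero by (auto simp: J_def)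
  next
    fix a b assume "a \<in> J" "b \<in> J"
    then obtain x y where "x \<in> N" "y \<in> N" "x - a *s f \<in> span F" "y - b *s f \<in> span F"
      by (auto simp: J_def)
    then have "x + y \<in> N" "(x + y) - (a + b) *s f \<in> span F"
      using subspace_add[OF insert.prems(1)] span_add[of "x - a *s f" F "y - b *s f"]
      by (auto simp: algebra_simps)
    then show "a + b \<in> J" by (auto simp: J_def)
  next
    fix c a assume "a \<in> J"
    then obtain x where "x \<in> N" "x - a *s f \<in> span F" by (auto simp: J_def)
    then have "c *s x \<in> N" "c *s x - (c * a) *s f \<in> span F"
      using subspace_scale[OF insert.prems(1)] span_scale[of "x - a *s f" F c]
      by (auto simp: algebra_simps)
    then show "c * a \<in> J" by (auto simp: J_def)
  qed
  then obtain X where X: "finite X" "J = ideal_gen X"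
    using noeth by (auto simp: noetherian_ring_def)
  then have "\<forall>r\<in>X. \<exists>x\<in>N. x - r *s f \<in> span F"
    using ideal_gen_superset[of X] by (auto simp: J_def)
  then obtain \<nu> where \<nu>: "\<And>r. r \<in> X \<Longrightarrow> \<nu> r \<in> N \<and> \<nu> r - r *s f \<in> span F" by metis
  have "subspace (N \<inter> span F)" using insert.prems by (simp add: subspace_inter)
  then obtain G where G: "finite G" "N \<inter> span F = span G"
    using insert.IH[of "N \<inter> span F"] by auto
  have "N \<subseteq> span (G \<union> \<nu> ` X)"
  proof
    fix y assume y: "y \<in> N"
    then obtain k where k: "y - k *s f \<in> span F" using insert.prems by (auto simp: span_insert)
    with y have "k \<in> ideal_gen X" using X by (auto simp: J_def)
    then obtain u where u: "k = (\<Sum>v\<in>X. u v * v)"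
      by (auto simp: ideal_gen_eq_span module.span_finite[OF module_mult X(1)])
    define y' where "y' = y - (\<Sum>v\<in>X. u v *s \<nu> v)"
    have "y' \<in> N"
      unfolding y'_def using y \<nu> insert.prems(1)
      by (intro subspace_diff subspace_sum subspace_scale) auto
    moreover have "y' = (y - k *s f) - (\<Sum>v\<in>X. u v *s (\<nu> v - v *s f))"
      by (simp add: y'_def u scale_right_diff_distrib sum_subtractf scale_sum_left)
    then have "y' \<in> span F"
      using k \<nu> by (metis (no_types, lifting) span_diff span_sum span_scale)
    ultimately have "y' \<in> span (G \<union> \<nu> ` X)" using G span_mono[of G "G \<union> \<nu> ` X"] by auto
    moreover have "(\<Sum>v\<in>X. u v *s \<nu> v) \<in> span (G \<union> \<nu> ` X)"
      by (intro span_sum span_scale span_base) simp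
    ultimately have "y' + (\<Sum>v\<in>X. u v *s \<nu> v) \<in> span (G \<union> \<nu> ` X)" by (rule span_add)
    then show "y \<in> span (G \<union> \<nu> ` X)" by (simp add: y'_def)
  qed
  moreover have "span (G \<union> \<nu> ` X) \<subseteq> N"
    using G \<nu> insert.prems(1) span_superset[of G] by (intro span_minimal) auto
  ultimately show ?case using G X by (intro exI[of _ "G \<union> \<nu> ` X"]) auto
qed

end

locale noetherian_module = module scale
  for scale :: "'a::comm_ring_1 \<Rightarrow> 'm::ab_group_add \<Rightarrow> 'm" (infixr \<open>*s\<close> 75) +
  assumes noetherian: "noetherian_ring TYPE('a)"
    and finitely_generated: "finitely_generated scale"
begin

lemma fg_subspace: "subspace N \<Longrightarrow> \<exists>G. finite G \<and> N = span G"
  using finitely_generated fg_submodule[OF noetherian]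
  by (metis finitely_generated_def submod_gen_eq_span subset_UNIV)

text \<open>The union of a chain is finitely generated, so a single member contains all the
  generators and equals the union; Zorn's lemma then applies.\<close>

lemma maximal_subspace:
  assumes "\<A> \<noteq> {}" and sub: "\<And>N. N \<in> \<A> \<Longrightarrow> subspace N"
  shows "\<exists>N\<in>\<A>. \<forall>N'\<in>\<A>. N \<subseteq> N' \<longrightarrow> N' = N"
proof (rule subset_Zorn_nonempty[OF assms(1)])
  fix \<C> assume \<C>: "\<C> \<noteq> {}" "subset.chain \<A> \<C>"
  then have "\<C> \<subseteq> \<A>" by (simp add: subset.chain_def)
  have lin: "X \<subseteq> Y \<or> Y \<subseteq> X" if "X \<in> \<C>" "Y \<in> \<C>" for X Y
    using \<C> that by (auto simp: subset_chain_def)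
  have "subspace (\<Union>\<C>)"
  proof (rule subspaceI)
    show "0 \<in> \<Union>\<C>" using \<C> \<open>\<C> \<subseteq> \<A>\<close> sub subspace_0 by blast
  next
    fix x y assume "x \<in> \<Union>\<C>" "y \<in> \<Union>\<C>"
    then obtain X Y where "X \<in> \<C>" "Y \<in> \<C>" "x \<in> X" "y \<in> Y" by blast
    then show "x + y \<in> \<Union>\<C>"
      using lin[of X Y] \<open>\<C> \<subseteq> \<A>\<close> sub subspace_add by (meson UnionI subsetD)
  next
    fix c x assume "x \<in> \<Union>\<C>"
    then show "c *s x \<in> \<Union>\<C>"
      using \<open>\<C> \<subseteq> \<A>\<close> sub subspace_scale by (meson Union_iff subsetD)
  qed
  then obtain G where G: "finite G" "\<Union>\<C> = span G" using fg_subspace by blast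
  obtain B where B: "B \<in> \<C>" "G \<subseteq> B"
    using finite_subset_Union_chain[OF G(1) _ \<C>] G span_superset by metis
  then have "\<Union>\<C> \<subseteq> B" using G \<open>\<C> \<subseteq> \<A>\<close> sub by (metis span_minimal subsetD)
  then have "\<Union>\<C> = B" using B by blast
  then show "\<Union>\<C> \<in> \<A>" using B \<open>\<C> \<subseteq> \<A>\<close> by blast
qed

end

lemma noetherian_module_mult:
  assumes "noetherian_ring TYPE('a::comm_ring_1)"
  shows "noetherian_module ((*) :: 'a \<Rightarrow> 'a \<Rightarrow> 'a)"
proof -
  interpret module "(*) :: 'a \<Rightarrow> 'a \<Rightarrow> 'a" by (rule module_mult)
  have "span {1 :: 'a} = UNIV" by (auto simp: span_singleton)
  then have "finitely_generated ((*) :: 'a \<Rightarrow> 'a \<Rightarrow> 'a)"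
    unfolding finitely_generated_def submod_gen_eq_span by (intro exI[of _ "{1}"]) simp
  then show ?thesis using assms by unfold_locales
qed

lemma maximal_ideal_exists:
  fixes \<A> :: "'a::comm_ring_1 set set"
  assumes "noetherian_ring TYPE('a)" "\<A> \<noteq> {}" "\<And>I. I \<in> \<A> \<Longrightarrow> is_ideal I"
  shows "\<exists>I\<in>\<A>. \<forall>J\<in>\<A>. I \<subseteq> J \<longrightarrow> J = I"
  using noetherian_module.maximal_subspace[OF noetherian_module_mult[OF assms(1)], of \<A>] assms(2,3)
  by (auto simp: is_ideal_iff_subspace)

text \<open>Noetherian induction. A maximal counterexample is not prime, so it contains some
  \<open>a * b\<close> but neither factor. Every prime over it contains one of the two larger ideals
  obtained by adjoining \<open>a\<close> or \<open>b\<close>, and their finite sets can be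
  united.\<close>

lemma finite_primes_below:
  fixes I :: "'a::comm_ring_1 set"
  assumes noeth: "noetherian_ring TYPE('a)" and "is_ideal I"
  shows "\<exists>S. finite S \<and> (\<forall>p\<in>S. prime_ideal p \<and> I \<subseteq> p) \<and>
    (\<forall>q. prime_ideal q \<longrightarrow> I \<subseteq> q \<longrightarrow> (\<exists>p\<in>S. p \<subseteq> q))"
proof -
  define good :: "'a set \<Rightarrow> 'a set set \<Rightarrow> bool" where
    "good I S \<longleftrightarrow> finite S \<and> (\<forall>p\<in>S. prime_ideal p \<and> I \<subseteq> p) \<and>
      (\<forall>q. prime_ideal q \<longrightarrow> I \<subseteq> q \<longrightarrow> (\<exists>p\<in>S. p \<subseteq> q))" for I S
  have below: "\<exists>p\<in>S. p \<subseteq> q" if "good I S" "prime_ideal q" "I \<subseteq> q" for I S q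
    using that by (simp add: good_def)
  define \<A> where "\<A> = {I. is_ideal I \<and> (\<nexists>S. good I S)}"
  have "\<A> = {}"
  proof (rule ccontr)
    assume "\<A> \<noteq> {}"
    then have "\<exists>I\<in>\<A>. \<forall>J\<in>\<A>. I \<subseteq> J \<longrightarrow> J = I"
      by (rule maximal_ideal_exists[OF noeth]) (simp add: \<A>_def)
    then obtain I where "I \<in> \<A>" and max: "\<And>J. J \<in> \<A> \<Longrightarrow> I \<subseteq> J \<Longrightarrow> J = I"
      by blast
    then have I: "is_ideal I" and bad: "\<And>S. \<not> good I S" by (auto simp: \<A>_def)
    have "\<not> prime_ideal I" using bad[of "{I}"] by (auto simp: good_def)
    moreover have "I \<noteq> UNIV" using bad[of "{}"] by (auto simp: prime_ideal_def good_def)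
    ultimately obtain a b where ab: "a * b \<in> I" "a \<notin> I" "b \<notin> I"
      using I by (auto simp: prime_ideal_def)
    define J where "J x = {i + x * r |i r. i \<in> I}" for x
    have J_ideal: "is_ideal (J x)" for x unfolding J_def by (rule is_ideal_add_principal[OF I])
    have J_mem: "i + x * r \<in> J x" if "i \<in> I" for i r x using that unfolding J_def by blast
    have JI: "I \<subseteq> J x" for x using J_mem[of _ x 0] by auto
    have J: "\<exists>S. good (J x) S" if "x \<notin> I" for x
    proof (rule ccontr)
      assume "\<nexists>S. good (J x) S"
      then have "J x = I" using max[of "J x"] JI J_ideal by (simp add: \<A>_def)
      then show False using J_mem[of 0 x 1] is_ideal_zero[OF I] that by simp
    qed
    obtain S where S: "good (J a) S" using J[OF ab(2)] by blast
    obtain T where T: "good (J b) T" using J[OF ab(3)] by blast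
    have "\<exists>p\<in>S \<union> T. p \<subseteq> q" if q: "prime_ideal q" "I \<subseteq> q" for q
    proof -
      have "J x \<subseteq> q" if "x \<in> q" for x
        using that q prime_ideal_is_ideal[OF q(1)]
        by (auto simp: J_def intro!: is_ideal_add is_ideal_mult_right)
      moreover have "a \<in> q \<or> b \<in> q" using ab(1) q by (auto simp flip: prime_ideal_mult_iff)
      ultimately have "J a \<subseteq> q \<or> J b \<subseteq> q" by blast
      then show ?thesis using below[OF S q(1)] below[OF T q(1)] by blast
    qed
    moreover have "prime_ideal p \<and> I \<subseteq> p" if "p \<in> S \<union> T" for p
    proof -
      have "prime_ideal p \<and> (J a \<subseteq> p \<or> J b \<subseteq> p)" using that S T by (auto simp: good_def)
      then show ?thesis using JI by blast
    qed
    moreover have "finite (S \<union> T)" using S T by (simp add: good_def)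
    ultimately have "good I (S \<union> T)" by (simp add: good_def)
    with bad show False by blast
  qed
  then have "\<exists>S. good I S" using assms(2) by (simp add: \<A>_def)
  then show ?thesis unfolding good_def .
qed


section \<open>Length of localisations and the principal ideal theorem\<close>

text \<open>For a prime \<open>P\<close>, the saturated submodules are the preimages of the
  submodules of the localisation at \<open>P\<close>.\<close>

definition saturated :: "('a::comm_ring_1 \<Rightarrow> 'm::ab_group_add \<Rightarrow> 'm) \<Rightarrow> 'a set \<Rightarrow> 'm set \<Rightarrow> bool" where
  "saturated s P N \<longleftrightarrow> (\<forall>r v. r \<notin> P \<longrightarrow> s r v \<in> N \<longrightarrow> v \<in> N)"

definition saturation :: "('a::comm_ring_1 \<Rightarrow> 'm::ab_group_add \<Rightarrow> 'm) \<Rightarrow> 'a set \<Rightarrow> 'm set \<Rightarrow> 'm set" where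
  "saturation s P N = {v. \<exists>r. r \<notin> P \<and> s r v \<in> N}"

text \<open>Strict chains of \<open>P\<close>-saturated submodules above \<open>K\<close> are the chains of submodules of the
  localisation of the quotient by \<open>K\<close> at \<open>P\<close>.\<close>

definition sat_chain ::
  "('a::comm_ring_1 \<Rightarrow> 'm::ab_group_add \<Rightarrow> 'm) \<Rightarrow> 'a set \<Rightarrow> 'm set \<Rightarrow> nat \<Rightarrow> (nat \<Rightarrow> 'm set) \<Rightarrow> bool" where
  "sat_chain s P K n N \<longleftrightarrow>
     (\<forall>i\<le>n. submod s (N i) \<and> saturated s P (N i) \<and> K \<subseteq> N i) \<and> (\<forall>i<n. N i \<subset> N (Suc i))"

context module
begin

lemma subset_saturation: "prime_ideal P \<Longrightarrow> N \<subseteq> saturation scale P N"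
  using prime_ideal_one by (auto simp: saturation_def intro!: exI[of _ 1])

lemma saturation_mono: "N \<subseteq> N' \<Longrightarrow> saturation scale P N \<subseteq> saturation scale P N'"
  by (auto simp: saturation_def)

lemma saturation_least: "saturated scale P L \<Longrightarrow> N \<subseteq> L \<Longrightarrow> saturation scale P N \<subseteq> L"
  by (auto simp: saturated_def saturation_def)

lemma saturated_saturation: "prime_ideal P \<Longrightarrow> saturated scale P (saturation scale P N)"
  unfolding saturated_def saturation_def
proof (intro allI impI, clarsimp)
  fix r v r' assume "prime_ideal P" "r \<notin> P" "r' \<notin> P" "(r' * r) *s v \<in> N"
  then show "\<exists>r. r \<notin> P \<and> r *s v \<in> N"
    by (intro exI[of _ "r' * r"]) (simp add: prime_ideal_mult_iff)
qed

lemma subspace_saturation: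
  assumes "prime_ideal P" "subspace N"
  shows "subspace (saturation scale P N)"
proof (rule subspaceI)
  show "0 \<in> saturation scale P N"
    using assms subset_saturation subspace_0 by blast
next
  fix x y assume "x \<in> saturation scale P N" "y \<in> saturation scale P N"
  then obtain a b where ab: "a \<notin> P" "a *s x \<in> N" "b \<notin> P" "b *s y \<in> N"
    by (auto simp: saturation_def)
  then have "b *s (a *s x) + a *s (b *s y) \<in> N"
    by (simp only: subspace_add[OF assms(2)] subspace_scale[OF assms(2)])
  then have "(a * b) *s (x + y) \<in> N" by (simp add: scale_right_distrib mult.commute)
  moreover have "a * b \<notin> P" using ab assms(1) by (simp add: prime_ideal_mult_iff)
  ultimately show "x + y \<in> saturation scale P N" by (auto simp: saturation_def)
next
  fix c x assume "x \<in> saturation scale P N"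
  then obtain a where a: "a \<notin> P" "a *s x \<in> N" by (auto simp: saturation_def)
  then have "c *s (a *s x) \<in> N" using subspace_scale[OF assms(2)] by blast
  then show "c *s x \<in> saturation scale P N"
    using a by (auto simp: saturation_def mult.commute)
qed

lemma mem_span_insert_subspace: "subspace N \<Longrightarrow> x \<in> span (insert v N) \<longleftrightarrow> (\<exists>k. x - k *s v \<in> N)"
  by (simp add: span_insert span_subspace[OF order_refl span_superset])

lemma is_ideal_colon:
  assumes "subspace N"
  shows "is_ideal {r. r *s v \<in> N}"
  unfolding is_ideal_def
  using subspace_0[OF assms] subspace_add[OF assms] subspace_scale[OF assms, of "_ *s v"]
  by (simp add: scale_left_distrib)

lemma is_ideal_ann:
  assumes "subspace K"
  shows "is_ideal (ann scale L K)"
proof -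
  have "ann scale L K = (\<Inter>v\<in>L. {r. r *s v \<in> K})" by (auto simp: ann_def)
  then show ?thesis using is_ideal_colon[OF assms] by (auto intro!: is_ideal_Inter)
qed

text \<open>Adding an element whose annihilator modulo \<open>L\<close> is \<open>P\<close> contributes length one.\<close>

lemma sat_chain_insert:
  assumes P: "prime_ideal P" and v: "{r. r *s v \<in> L} = P"
    and ch: "sat_chain scale P L (Suc n) N"
  shows "\<exists>N'. sat_chain scale P (span (insert v L)) n N'"
proof -
  \<comment> \<open>As long as \<open>v\<close> is missing from the chain it is adjoined and the
    result saturated; once \<open>v\<close> is present the old chain is used one index further on.
    This shift is the single step that \<open>v\<close> costs.\<close>
  define S where "S i = saturation scale P (span (insert v (N i)))" for i
  define N' where "N' i = (if v \<in> N i then N (Suc i) else S i)" for i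
  have N: "subspace (N i)" "saturated scale P (N i)" "L \<subseteq> N i" if "i \<le> Suc n" for i
    using ch that by (auto simp: sat_chain_def submod_eq_subspace)
  have strict: "N i \<subset> N (Suc i)" if "i \<le> n" for i
    using ch that by (simp add: sat_chain_def)
  have S: "subspace (S i)" "saturated scale P (S i)" "span (insert v L) \<subseteq> S i" if "i \<le> Suc n" for i
  proof -
    show "subspace (S i)" unfolding S_def by (intro subspace_saturation[OF P] subspace_span)
    show "saturated scale P (S i)" unfolding S_def by (rule saturated_saturation[OF P])
    have "span (insert v L) \<subseteq> span (insert v (N i))" using N(3)[OF that] by (intro span_mono) auto
    then show "span (insert v L) \<subseteq> S i" unfolding S_def using subset_saturation[OF P] by blast
  qed
  have S_le: "S i \<subseteq> N (Suc i)" if "i \<le> n" "v \<in> N (Suc i)" for i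
    unfolding S_def using that N[of "Suc i"] strict[of i]
    by (intro saturation_least span_minimal) auto
  have S_strict: "S i \<subset> S (Suc i)" if "i \<le> n" "v \<notin> N (Suc i)" for i
  proof -
    have "S i \<subseteq> S (Suc i)"
      unfolding S_def using strict[of i] that by (intro saturation_mono span_mono) auto
    \<comment> \<open>If \<open>x\<close> in \<open>N (Suc i)\<close> satisfied
      \<open>r *s x = k *s v\<close> modulo \<open>N i\<close> with \<open>r\<close> outside
      \<open>P\<close>, then \<open>k *s v\<close> would lie in \<open>N (Suc i)\<close>. This
      submodule is saturated and misses \<open>v\<close>, so \<open>k\<close> is in \<open>P\<close>
      and kills \<open>v\<close> modulo \<open>L\<close>, which drops \<open>x\<close> into
      \<open>N i\<close>.\<close>
    moreover have "\<not> S (Suc i) \<subseteq> S i"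
    proof
      assume "S (Suc i) \<subseteq> S i"
      moreover have "N (Suc i) \<subseteq> S (Suc i)"
        unfolding S_def using subset_saturation[OF P] span_superset[of "insert v (N (Suc i))"]
        by (meson insert_subset order_trans)
      ultimately have le: "N (Suc i) \<subseteq> S i" by simp
      have "x \<in> N i" if x: "x \<in> N (Suc i)" for x
      proof -
        obtain r where r: "r \<notin> P" "r *s x \<in> span (insert v (N i))"
          using le x by (auto simp: S_def saturation_def)
        then obtain k where k: "r *s x - k *s v \<in> N i"
          using mem_span_insert_subspace[OF N(1)] \<open>i \<le> n\<close> by auto
        then have "r *s x - k *s v \<in> N (Suc i)" using strict[OF \<open>i \<le> n\<close>] by blast
        moreover have sub: "subspace (N (Suc i))" using N \<open>i \<le> n\<close> by simp
        ultimately have "r *s x - (r *s x - k *s v) \<in> N (Suc i)"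
          using \<open>r *s x - k *s v \<in> N (Suc i)\<close> x by (simp only: subspace_diff subspace_scale)
        then have "k *s v \<in> N (Suc i)" by simp
        then have "k \<in> P"
          using \<open>v \<notin> N (Suc i)\<close> N(2)[of "Suc i"] \<open>i \<le> n\<close> by (auto simp: saturated_def)
        then have "k *s v \<in> N i" using v N(3)[of i] \<open>i \<le> n\<close> by auto
        then have "(r *s x - k *s v) + k *s v \<in> N i"
          using k N(1) \<open>i \<le> n\<close> by (intro subspace_add) auto
        then show "x \<in> N i" using r N(2)[of i] \<open>i \<le> n\<close> by (auto simp: saturated_def)
      qed
      then show False using strict[OF \<open>i \<le> n\<close>] by blast
    qed
    ultimately show ?thesis by blast
  qed
  have "subspace (N' i) \<and> saturated scale P (N' i) \<and> span (insert v L) \<subseteq> N' i" if "i \<le> n" for i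
  proof (cases "v \<in> N i")
    case True
    then have "v \<in> N (Suc i)" using strict[OF that] by blast
    then have "span (insert v L) \<subseteq> N (Suc i)"
      using N[of "Suc i"] that by (intro span_minimal) auto
    then show ?thesis using N[of "Suc i"] that True by (simp add: N'_def)
  next
    case False
    then show ?thesis using S that by (simp add: N'_def)
  qed
  moreover have "N' i \<subset> N' (Suc i)" if "i < n" for i
  proof (cases "v \<in> N i")
    case True
    then have "v \<in> N (Suc i)" using strict[of i] that by auto
    then show ?thesis using True strict[of "Suc i"] that by (simp add: N'_def)
  next
    case False
    then show ?thesis using S_le[of i] S_strict[of i] strict[of "Suc i"] that
      by (auto simp: N'_def)
  qed
  ultimately show ?thesis by (auto simp: sat_chain_def submod_eq_subspace)
qed

end

context noetherian_module
begin

text \<open>A maximal one among the annihilators of nonzero elements modulo \<open>L\<close> is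
  prime: passing from \<open>v\<close> to \<open>b *s v\<close> can only enlarge the annihilator,
  hence leaves it unchanged.\<close>

lemma associated_prime:
  assumes "subspace L" "L \<noteq> UNIV"
  obtains v where "v \<notin> L" "prime_ideal {r. r *s v \<in> L}"
proof -
  let ?q = "\<lambda>v. {r. r *s v \<in> L}"
  have "?q ` (- L) \<noteq> {}" using assms(2) by auto
  then have "\<exists>I\<in>?q ` (- L). \<forall>J\<in>?q ` (- L). I \<subseteq> J \<longrightarrow> J = I"
    by (rule maximal_ideal_exists[OF noetherian]) (auto simp only: is_ideal_colon[OF assms(1)])
  then obtain v where v: "v \<notin> L" and max: "\<And>w. w \<notin> L \<Longrightarrow> ?q v \<subseteq> ?q w \<Longrightarrow> ?q w = ?q v"
    by auto
  have "a \<in> ?q v" if ab: "a * b \<in> ?q v" and b: "b \<notin> ?q v" for a b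
  proof -
    have "?q v \<subseteq> ?q (b *s v)"
    proof
      fix r assume "r \<in> ?q v"
      then have "b *s (r *s v) \<in> L" using subspace_scale[OF assms(1)] by blast
      then show "r \<in> ?q (b *s v)" by (simp add: mult.commute)
    qed
    then have "?q (b *s v) = ?q v" using max[of "b *s v"] b by simp
    moreover have "a \<in> ?q (b *s v)" using ab by simp
    ultimately show ?thesis by blast
  qed
  moreover have "1 \<notin> ?q v" using v by simp
  ultimately have "prime_ideal (?q v)"
    unfolding prime_ideal_def using is_ideal_colon[OF assms(1)] by blast
  with v that show thesis by blast
qed

text \<open>By \<open>only\<close>, the localisation at \<open>P\<close> of the quotient by
  \<open>K\<close> is supported at most at \<open>P\<close>. A maximal submodule \<open>L\<close>
  with unbounded chains is saturated, so an associated prime modulo \<open>L\<close> lies in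
  \<open>P\<close> and therefore equals \<open>P\<close>; adjoining the corresponding element
  changes the length by at most one.\<close>

lemma local_length_bounded:
  assumes P: "prime_ideal P" and K: "subspace K"
    and only: "\<And>q. prime_ideal q \<Longrightarrow> {r. \<forall>v. r *s v \<in> K} \<subseteq> q \<Longrightarrow> q \<subseteq> P \<Longrightarrow> q = P"
  shows "\<exists>b. \<forall>n N. sat_chain scale P K n N \<longrightarrow> n \<le> b"
proof -
  define bounded where "bounded L \<longleftrightarrow> (\<exists>b. \<forall>n N. sat_chain scale P L n N \<longrightarrow> n \<le> b)" for L
  define \<A> where "\<A> = {L. subspace L \<and> K \<subseteq> L \<and> \<not> bounded L}"
  have "\<A> = {}"
  proof (rule ccontr)
    assume "\<A> \<noteq> {}"
    then have "\<exists>L\<in>\<A>. \<forall>L'\<in>\<A>. L \<subseteq> L' \<longrightarrow> L' = L"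
      by (rule maximal_subspace) (simp add: \<A>_def)
    then obtain L where "L \<in> \<A>" and max: "\<And>L'. L' \<in> \<A> \<Longrightarrow> L \<subseteq> L' \<Longrightarrow> L' = L"
      by blast
    then have L: "subspace L" "K \<subseteq> L" "\<not> bounded L" by (simp_all add: \<A>_def)
    \<comment> \<open>The members of a chain over \<open>L\<close> are saturated, so they contain
      the saturation of \<open>L\<close> as well; maximality then makes \<open>L\<close>
      saturated.\<close>
    have "sat_chain scale P (saturation scale P L) n N" if "sat_chain scale P L n N" for n N
      using that saturation_least[of P _ L] by (auto simp: sat_chain_def)
    then have "\<not> bounded (saturation scale P L)" using L(3) unfolding bounded_def by blast
    then have "saturation scale P L \<in> \<A>"
      using L subset_saturation[OF P, of L] subspace_saturation[OF P L(1)] by (auto simp: \<A>_def)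
    then have sat: "saturation scale P L = L" using max subset_saturation[OF P] by blast
    have "n \<le> 0" if "sat_chain scale P UNIV n N" for n N
    proof (rule ccontr)
      assume "\<not> n \<le> 0"
      then have "N 0 \<subset> N (Suc 0)" "UNIV \<subseteq> N 0" using that by (auto simp: sat_chain_def)
      then show False by blast
    qed
    then have "bounded UNIV" unfolding bounded_def by blast
    then have "L \<noteq> UNIV" using L(3) by blast
    then obtain v where v: "v \<notin> L" "prime_ideal {r. r *s v \<in> L}"
      using associated_prime[OF L(1)] by blast
    have "{r. r *s v \<in> L} \<subseteq> P"
    proof
      fix r assume "r \<in> {r. r *s v \<in> L}"
      then show "r \<in> P" using v(1) sat by (auto simp: saturation_def)
    qed
    then have vP: "{r. r *s v \<in> L} = P" using only[OF v(2)] L(2) by blast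
    have le: "L \<subseteq> span (insert v L)" using span_superset[of "insert v L"] by blast
    have "span (insert v L) \<noteq> L" using v(1) span_base[of v "insert v L"] by auto
    then have "span (insert v L) \<notin> \<A>" using max le by blast
    then have "bounded (span (insert v L))" using le L(2) by (auto simp: \<A>_def)
    then obtain b where b: "\<And>n N. sat_chain scale P (span (insert v L)) n N \<Longrightarrow> n \<le> b"
      unfolding bounded_def by blast
    have "n \<le> Suc b" if "sat_chain scale P L n N" for n N
    proof (cases n)
      case (Suc k)
      then show ?thesis using sat_chain_insert[OF P vP] that b by (metis Suc_le_mono)
    qed simp
    then have "bounded L" unfolding bounded_def by blast
    with L(3) show False by blast
  qed
  then have "bounded K" using K by (auto simp: \<A>_def)
  then show ?thesis by (simp add: bounded_def)
qed

end

text \<open>The ideals \<open>Q n\<close> below are the preimages of the ideals \<open>(y\<^sup>n)\<close> of the localisation of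
  \<open>R/p\<close> at \<open>q\<close>; they replace the symbolic powers of \<open>q\<close> in the usual argument.\<close>

theorem krull_principal_ideal:
  fixes P :: "'a::comm_ring_1 set"
  assumes noeth: "noetherian_ring TYPE('a)"
    and p: "prime_ideal p" and q: "prime_ideal q" and P: "prime_ideal P"
    and pq: "p \<subset> q" and qP: "q \<subset> P" and x: "x \<in> P"
  shows "\<exists>p'. prime_ideal p' \<and> p \<subseteq> p' \<and> x \<in> p' \<and> p' \<subset> P"
proof (rule ccontr)
  assume contr: "\<not> ?thesis"
  have pI: "is_ideal p" and qI: "is_ideal q" and PI: "is_ideal P"
    using p q P by (simp_all add: prime_ideal_is_ideal)
  \<comment> \<open>Otherwise \<open>q\<close> itself would be the prime sought.\<close>
  have xq: "x \<notin> q" using contr q pq qP by blast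
  obtain y where y: "y \<in> q" "y \<notin> p" using pq by blast
  define Q where "Q n = {r. \<exists>\<sigma> b. \<sigma> \<notin> q \<and> \<sigma> * r - y ^ n * b \<in> p}" for n
  have QI: "is_ideal (Q n)" for n
    unfolding is_ideal_def
  proof (intro conjI ballI allI)
    have "1 \<notin> q \<and> 1 * 0 - y ^ n * 0 \<in> p"
      using prime_ideal_one[OF q] is_ideal_zero[OF pI] by simp
    then show "0 \<in> Q n" unfolding Q_def by blast
  next
    fix u v assume "u \<in> Q n" "v \<in> Q n"
    then obtain \<sigma> b \<tau> c where *: "\<sigma> \<notin> q" "\<sigma> * u - y ^ n * b \<in> p" "\<tau> \<notin> q" "\<tau> * v - y ^ n * c \<in> p"
      unfolding Q_def by blast
    have "\<tau> * (\<sigma> * u - y ^ n * b) + \<sigma> * (\<tau> * v - y ^ n * c) \<in> p"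
      using * by (intro is_ideal_add[OF pI] is_ideal_mult[OF pI])
    also have "\<tau> * (\<sigma> * u - y ^ n * b) + \<sigma> * (\<tau> * v - y ^ n * c)
        = (\<sigma> * \<tau>) * (u + v) - y ^ n * (\<tau> * b + \<sigma> * c)" by (simp add: algebra_simps)
    finally show "u + v \<in> Q n"
      unfolding Q_def using * prime_ideal_mult_iff[OF q, of \<sigma> \<tau>] by blast
  next
    fix r u assume "u \<in> Q n"
    then obtain \<sigma> b where *: "\<sigma> \<notin> q" "\<sigma> * u - y ^ n * b \<in> p" unfolding Q_def by blast
    have "r * (\<sigma> * u - y ^ n * b) \<in> p" using * by (intro is_ideal_mult[OF pI])
    also have "r * (\<sigma> * u - y ^ n * b) = \<sigma> * (r * u) - y ^ n * (r * b)" by (simp add: algebra_simps)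
    finally show "r * u \<in> Q n" unfolding Q_def using * by blast
  qed
  have Q_sat: "a \<in> Q n" if \<tau>: "\<tau> \<notin> q" and a: "\<tau> * a \<in> Q n" for \<tau> a n
  proof -
    obtain \<sigma> b where *: "\<sigma> \<notin> q" "\<sigma> * (\<tau> * a) - y ^ n * b \<in> p" using a unfolding Q_def by blast
    then have "(\<sigma> * \<tau>) * a - y ^ n * b \<in> p" by (simp add: mult.assoc)
    then show ?thesis unfolding Q_def using * \<tau> prime_ideal_mult_iff[OF q, of \<sigma> \<tau>] by blast
  qed
  have pQ: "p \<subseteq> Q n" for n
  proof
    fix a assume "a \<in> p"
    then have "1 \<notin> q \<and> 1 * a - y ^ n * 0 \<in> p" using prime_ideal_one[OF q] by simp
    then show "a \<in> Q n" unfolding Q_def by blast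
  qed
  have Q_dec: "Q (Suc n) \<subseteq> Q n" for n
    unfolding Q_def by (auto simp: mult.assoc mult.left_commute[of y])
  \<comment> \<open>The preimages of \<open>Q n + (x)\<close> in the localisation at
    \<open>P\<close>. They descend and contain \<open>K\<close>, so a length bound over
    \<open>K\<close> makes them stationary.\<close>
  define S where "S n = saturation (*) P {a + x * r |a r. a \<in> Q n}" for n
  define K where "K = {a + x * r |a r. a \<in> p}"
  interpret R: noetherian_module "(*) :: 'a \<Rightarrow> 'a \<Rightarrow> 'a" by (rule noetherian_module_mult[OF noeth])
  have S_sub: "submod (*) (S n)" for n
    unfolding S_def R.submod_eq_subspace
    using is_ideal_add_principal[OF QI] by (intro R.subspace_saturation[OF P]) (simp add: is_ideal_iff_subspace)
  have S_sat: "saturated (*) P (S n)" for n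
    unfolding S_def by (rule R.saturated_saturation[OF P])
  have "K \<subseteq> {a + x * r |a r. a \<in> Q n}" for n using pQ[of n] unfolding K_def by blast
  then have KS: "K \<subseteq> S n" for n unfolding S_def using R.subset_saturation[OF P] by (meson order_trans)
  have "{a + x * r |a r. a \<in> Q (Suc n)} \<subseteq> {a + x * r |a r. a \<in> Q n}" for n using Q_dec[of n] by blast
  then have S_dec: "S (Suc n) \<subseteq> S n" for n unfolding S_def by (rule R.saturation_mono)
  have KI: "is_ideal K" unfolding K_def by (rule is_ideal_add_principal[OF pI])
  \<comment> \<open>Failure of the claim means that \<open>P\<close> is minimal over
    \<open>K = p + (x)\<close>.\<close>
  have "\<exists>b. \<forall>n N. sat_chain (*) P K n N \<longrightarrow> n \<le> b"
  proof (rule R.local_length_bounded[OF P])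
    show "R.subspace K" using KI by (simp add: is_ideal_iff_subspace)
    fix q' assume q': "prime_ideal q'" "{r. \<forall>v. r * v \<in> K} \<subseteq> q'" "q' \<subseteq> P"
    have K_le: "K \<subseteq> q'" using q'(2) is_ideal_mult_right[OF KI] by blast
    have "a + x * 0 \<in> K" if "a \<in> p" for a unfolding K_def using that by blast
    then have "p \<subseteq> q'" using K_le by auto
    moreover have "0 + x * 1 \<in> K" unfolding K_def using is_ideal_zero[OF pI] by blast
    then have "x \<in> q'" using K_le by auto
    ultimately show "q' = P" using contr q' by blast
  qed
  then obtain b where b: "\<And>n N. sat_chain (*) P K n N \<Longrightarrow> n \<le> b" by blast
  have "\<exists>n. S (Suc n) = S n"
  proof (rule ccontr)
    assume "\<nexists>n. S (Suc n) = S n"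
    then have strict: "S (Suc n) \<subset> S n" for n using S_dec by blast
    \<comment> \<open>The index is reversed because the \<open>S n\<close> descend; the length
      \<open>Suc b\<close> exceeds the bound by one.\<close>
    have "sat_chain (*) P K (Suc b) (\<lambda>i. S (Suc b - i))"
      unfolding sat_chain_def
    proof (intro conjI allI impI)
      fix i assume "i < Suc b"
      then show "S (Suc b - i) \<subset> S (Suc b - Suc i)" using strict[of "b - i"] by (simp add: Suc_diff_le)
    qed (use S_sub S_sat KS in auto)
    then show False using b by fastforce
  qed
  then obtain n where n: "S (Suc n) = S n" by blast
  have "R.subspace (Q n)" using QI by (simp add: is_ideal_iff_subspace)
  then obtain G where G: "finite G" "Q n = R.span G" using R.fg_subspace by blast
  \<comment> \<open>Up to a factor outside \<open>P\<close>, stationarity gives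
    \<open>g = a + x * r\<close> with \<open>a\<close> in \<open>Q (Suc n)\<close>. Then
    \<open>x * r\<close> is in \<open>Q n\<close>, and so is \<open>r\<close>, because
    \<open>x\<close> is outside \<open>q\<close>. Expanding \<open>r\<close> in \<open>G\<close>
    gives coefficients \<open>x * u h\<close> in \<open>P\<close>, as Nakayama's lemma
    requires.\<close>
  have "\<exists>t. t \<notin> P \<and> (\<forall>g\<in>G. t * g \<in> Q (Suc n))"
  proof (rule R.nakayama_at_prime[OF P _ G(1)])
    show "R.subspace (Q (Suc n))" using QI by (simp add: is_ideal_iff_subspace)
    fix g assume "g \<in> G"
    then have g: "g \<in> Q n" using G R.span_superset by blast
    then have "g + x * 0 \<in> {a + x * r |a r. a \<in> Q n}" by blast
    then have "g + x * 0 \<in> S n" unfolding S_def by (rule subsetD[OF R.subset_saturation[OF P]])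
    then have "g \<in> S (Suc n)" by (simp add: n)
    then obtain \<sigma> a r where \<sigma>: "\<sigma> \<notin> P" "\<sigma> * g = a + x * r" "a \<in> Q (Suc n)"
      unfolding S_def saturation_def by blast
    have "\<sigma> * g - a \<in> Q n" using g \<sigma> Q_dec[of n] by (intro is_ideal_diff[OF QI] is_ideal_mult[OF QI]) auto
    then have "x * r \<in> Q n" using \<sigma> by simp
    then have "r \<in> Q n" using Q_sat xq by blast
    then obtain u where u: "r = (\<Sum>h\<in>G. u h * h)" using G by (auto simp: R.span_finite)
    have "\<sigma> * g - (\<Sum>h\<in>G. x * u h * h) = a"
      by (simp add: \<sigma> u sum_distrib_left mult.assoc del: R.scale_scale)
    then have "\<sigma> * g - (\<Sum>h\<in>G. x * u h * h) \<in> Q (Suc n)" using \<sigma> by simp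
    moreover have "\<forall>h\<in>G. x * u h \<in> P" using x is_ideal_mult_right[OF PI] by blast
    ultimately show "\<exists>\<sigma> c. \<sigma> \<notin> P \<and> (\<forall>h\<in>G. c h \<in> P) \<and> \<sigma> * g - (\<Sum>h\<in>G. c h * h) \<in> Q (Suc n)"
      using \<sigma>(1) by (intro exI[of _ \<sigma>] exI[of _ "\<lambda>h. x * u h"]) simp
  qed
  then obtain t where t: "t \<notin> P" "\<And>g. g \<in> G \<Longrightarrow> t * g \<in> Q (Suc n)" by blast
  \<comment> \<open>For \<open>y ^ n\<close> the inclusion just obtained says that
    \<open>\<sigma> * t * y ^ n\<close> is a multiple of \<open>y ^ Suc n\<close> modulo
    \<open>p\<close>. Cancelling \<open>y ^ n\<close> puts \<open>\<sigma> * t\<close> into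
    \<open>q\<close>, although neither factor lies there.\<close>
  have "1 \<notin> q \<and> 1 * y ^ n - y ^ n * 1 \<in> p"
    using prime_ideal_one[OF q] is_ideal_zero[OF pI] by simp
  then have "y ^ n \<in> Q n" unfolding Q_def by blast
  then obtain u where u: "y ^ n = (\<Sum>h\<in>G. u h * h)" using G by (auto simp: R.span_finite)
  have "(\<Sum>h\<in>G. u h * (t * h)) \<in> Q (Suc n)"
    using QI t by (intro R.subspace_sum) (auto simp: is_ideal_iff_subspace[symmetric] is_ideal_mult simp del: R.scale_scale)
  also have "(\<Sum>h\<in>G. u h * (t * h)) = t * y ^ n"
    by (simp add: u sum_distrib_left mult.left_commute del: R.scale_scale)
  finally obtain \<sigma> b where \<sigma>: "\<sigma> \<notin> q" "\<sigma> * (t * y ^ n) - y ^ Suc n * b \<in> p" unfolding Q_def by blast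
  have "\<sigma> * (t * y ^ n) - y ^ Suc n * b = y ^ n * (\<sigma> * t - y * b)"
    by (simp add: algebra_simps del: R.scale_scale R.scale_right_diff_distrib R.scale_left_diff_distrib)
  then have "y ^ n * (\<sigma> * t - y * b) \<in> p" using \<sigma> by simp
  then have "\<sigma> * t - y * b \<in> p" using prime_ideal_mult_iff[OF p] prime_ideal_power[OF p] y by blast
  then have "(\<sigma> * t - y * b) + y * b \<in> q" using pq y by (intro is_ideal_add[OF qI] is_ideal_mult_right[OF qI]) auto
  then have "\<sigma> * t \<in> q" by simp
  then show False using prime_ideal_mult_iff[OF q] \<sigma> t qP by blast
qed

section \<open>Chains of primes\<close>

definition prime_chain :: "'a::comm_ring_1 set \<Rightarrow> nat \<Rightarrow> (nat \<Rightarrow> 'a set) \<Rightarrow> bool" where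
  "prime_chain I n P \<longleftrightarrow> (\<forall>i\<le>n. prime_ideal (P i) \<and> I \<subseteq> P i) \<and> (\<forall>i<n. P i \<subset> P (Suc i))"

lemma krull_dim_altdef: "krull_dim I = Sup {enat n |n. \<exists>P. prime_chain I n P}"
  by (simp add: krull_dim_def prime_chain_def)

lemma krull_dim_cong:
  assumes "\<And>p. prime_ideal p \<Longrightarrow> I \<subseteq> p \<longleftrightarrow> J \<subseteq> p"
  shows "krull_dim I = krull_dim J"
proof -
  have "prime_chain I n P = prime_chain J n P" for n P
    unfolding prime_chain_def using assms by blast
  then show ?thesis by (simp add: krull_dim_altdef)
qed

lemma krull_dim_eqI:
  assumes "prime_chain I n P" "\<And>k P. prime_chain I k P \<Longrightarrow> k \<le> n"
  shows "krull_dim I = enat n"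
  unfolding krull_dim_altdef using assms by (intro antisym Sup_least Sup_upper) auto

text \<open>The value 0 is excluded because it is also the supremum over no chains at all, as for
  the unit ideal.\<close>

lemma krull_dim_attained:
  assumes "krull_dim I = enat n" "n > 0"
  shows "\<exists>P. prime_chain I n P"
proof -
  define X where "X = {enat n |n. \<exists>P. prime_chain I n P}"
  have X: "Sup X = enat n" using assms by (simp add: krull_dim_altdef X_def)
  then have "X \<noteq> {}" using assms(2) by (auto simp: Sup_enat_def zero_enat_def)
  moreover from this have "finite X" using X by (auto simp: Sup_enat_def split: if_splits)
  ultimately have "enat n \<in> X" using X Max_in[of X] by (simp add: Sup_enat_def)
  then show ?thesis by (auto simp: X_def)
qed

lemma prime_chain_append:
  assumes "prime_chain I n P" "prime_ideal p" "P n \<subset> p"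
  shows "prime_chain I (Suc n) (P(Suc n := p))"
  using assms by (auto simp: prime_chain_def less_Suc_eq le_Suc_eq)

lemma prime_chain_Suc:
  assumes "prime_chain I (Suc n) P"
  shows "prime_chain I n P" "prime_ideal (P (Suc n))" "P n \<subset> P (Suc n)"
  using assms by (auto simp: prime_chain_def)

text \<open>Work from the top: the principal ideal theorem replaces the prime below the top by one
  that contains \<open>x\<close> and still lies strictly between its neighbours. It then serves as
  top for the shorter chain, and the smallest prime is given up at the end.\<close>

lemma prime_chain_insert:
  fixes x :: "'a::comm_ring_1"
  assumes noeth: "noetherian_ring TYPE('a)" and "prime_chain I (Suc n) P" "x \<in> P (Suc n)"
  shows "\<exists>Q. prime_chain (insert x I) n Q \<and> Q n = P (Suc n)"
  using assms(2-)
proof (induction n arbitrary: P)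
  case 0
  then show ?case by (intro exI[of _ "\<lambda>_. P (Suc 0)"]) (auto simp: prime_chain_def)
next
  case (Suc n)
  note ch = prime_chain_Suc[OF Suc.prems(1)]
  note ch' = prime_chain_Suc[OF ch(1)]
  have pn: "prime_ideal (P n)" using Suc.prems(1) by (simp add: prime_chain_def)
  have "\<exists>p. prime_ideal p \<and> P n \<subset> p \<and> x \<in> p \<and> p \<subset> P (Suc (Suc n))"
  proof (cases "x \<in> P (Suc n)")
    case True
    then show ?thesis using ch ch' by blast
  next
    case False
    obtain p where "prime_ideal p" "P n \<subseteq> p" "x \<in> p" "p \<subset> P (Suc (Suc n))"
      using krull_principal_ideal[OF noeth pn ch'(2) ch(2) ch'(3) ch(3) Suc.prems(2)] by blast
    moreover have "x \<notin> P n" using False ch'(3) by blast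
    ultimately show ?thesis by blast
  qed
  then obtain p where p: "prime_ideal p" "P n \<subset> p" "x \<in> p" "p \<subset> P (Suc (Suc n))" by blast
  have "prime_chain I (Suc n) (P(Suc n := p))"
    by (rule prime_chain_append[OF ch'(1) p(1,2)])
  from Suc.IH[OF this] p(3) obtain Q where Q: "prime_chain (insert x I) n Q" "Q n = p"
    by auto
  then have "prime_chain (insert x I) (Suc n) (Q(Suc n := P (Suc (Suc n))))"
    using ch(2) p(4) by (intro prime_chain_append) auto
  moreover have "(Q(Suc n := P (Suc (Suc n)))) (Suc n) = P (Suc (Suc n))" by simp
  ultimately show ?case by blast
qed


section \<open>Systems of parameters\<close>

lemma maximal_max_ideal:
  "noetherian_local_ring TYPE('a::comm_ring_1) \<Longrightarrow> maximal_ideal (max_ideal :: 'a set)"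
  unfolding max_ideal_def noetherian_local_ring_def by (blast intro: theI')

lemma is_ideal_max_ideal:
  "noetherian_local_ring TYPE('a::comm_ring_1) \<Longrightarrow> is_ideal (max_ideal :: 'a set)"
  using maximal_max_ideal[where 'a='a] by (simp add: maximal_ideal_def)

lemma ideal_subset_max_ideal:
  fixes I :: "'a::comm_ring_1 set"
  assumes loc: "noetherian_local_ring TYPE('a)" and I: "is_ideal I" "I \<noteq> UNIV"
  shows "I \<subseteq> max_ideal"
proof -
  define \<A> where "\<A> = {J. is_ideal J \<and> I \<subseteq> J \<and> J \<noteq> UNIV}"
  have "\<A> \<noteq> {}" using I by (auto simp: \<A>_def)
  then have "\<exists>J\<in>\<A>. \<forall>J'\<in>\<A>. J \<subseteq> J' \<longrightarrow> J' = J"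
    using loc by (intro maximal_ideal_exists) (simp_all add: \<A>_def noetherian_local_ring_def)
  then obtain J where J: "J \<in> \<A>" and max: "\<And>J'. J' \<in> \<A> \<Longrightarrow> J \<subseteq> J' \<Longrightarrow> J' = J" by blast
  have "maximal_ideal J"
    unfolding maximal_ideal_def
  proof (intro conjI allI impI)
    fix J' assume J': "is_ideal J' \<and> J \<subseteq> J'"
    show "J' = J \<or> J' = UNIV"
    proof (cases "J' = UNIV")
      case False
      then have "J' \<in> \<A>" using J J' by (auto simp: \<A>_def)
      then show ?thesis using max J' by blast
    qed simp
  qed (use J in \<open>auto simp: \<A>_def\<close>)
  then have "J = max_ideal"
    using maximal_max_ideal[OF loc] loc unfolding noetherian_local_ring_def by blast
  then show ?thesis using J by (simp add: \<A>_def)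
qed

lemma unit_outside_max_ideal:
  fixes r :: "'a::comm_ring_1"
  assumes loc: "noetherian_local_ring TYPE('a)" and r: "r \<notin> max_ideal"
  shows "\<exists>u. u * r = 1"
proof (rule ccontr)
  assume nu: "\<nexists>u. u * r = 1"
  have "is_ideal {a + r * u |a u. a \<in> {0}}"
    by (rule is_ideal_add_principal) (simp add: is_ideal_def)
  moreover have "1 \<notin> {a + r * u |a u. a \<in> {0}}" using nu by (auto simp: mult.commute)
  ultimately have "{a + r * u |a u. a \<in> {0}} \<subseteq> max_ideal"
    using ideal_subset_max_ideal[OF loc] by blast
  then have "0 + r * 1 \<in> max_ideal" by blast
  with r show False by simp
qed

lemma prime_max_ideal:
  assumes loc: "noetherian_local_ring TYPE('a::comm_ring_1)"
  shows "prime_ideal (max_ideal :: 'a set)"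
proof -
  note m = is_ideal_max_ideal[OF loc]
  have "b \<in> max_ideal" if ab: "a * b \<in> max_ideal" and a: "a \<notin> max_ideal" for a b :: 'a
  proof -
    obtain u where "u * a = 1" using unit_outside_max_ideal[OF loc a] by blast
    then have "u * (a * b) = b" by (simp flip: mult.assoc)
    then show ?thesis using is_ideal_mult[OF m ab, of u] by simp
  qed
  then show ?thesis
    using maximal_max_ideal[OF loc] m by (auto simp: prime_ideal_def maximal_ideal_def)
qed

lemma prime_subset_max_ideal:
  assumes "noetherian_local_ring TYPE('a::comm_ring_1)" "prime_ideal (p :: 'a set)"
  shows "p \<subseteq> max_ideal"
  using assms by (intro ideal_subset_max_ideal) (auto simp: prime_ideal_def)

text \<open>The top of a chain may be replaced by the maximal ideal, which contains the next element
  of \<open>xs\<close>; each element then costs one step.\<close>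

lemma prime_chain_drop:
  fixes xs :: "'a::comm_ring_1 list"
  assumes loc: "noetherian_local_ring TYPE('a)"
  shows "prime_chain I (n + length xs) P \<Longrightarrow> set xs \<subseteq> max_ideal \<Longrightarrow> \<exists>Q. prime_chain (I \<union> set xs) n Q"
proof (induction xs arbitrary: P I)
  case Nil
  then show ?case by auto
next
  case (Cons x xs)
  have "prime_chain I (Suc (n + length xs)) P" using Cons.prems by simp
  note ch = prime_chain_Suc[OF this]
  have "P (n + length xs) \<subset> max_ideal" using ch(3) prime_subset_max_ideal[OF loc ch(2)] by blast
  then have "prime_chain I (Suc (n + length xs)) (P(Suc (n + length xs) := max_ideal))"
    by (rule prime_chain_append[OF ch(1) prime_max_ideal[OF loc]])
  moreover have "x \<in> (P(Suc (n + length xs) := max_ideal)) (Suc (n + length xs))"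
    using Cons.prems(2) by simp
  moreover have "noetherian_ring TYPE('a)" using loc by (simp add: noetherian_local_ring_def)
  ultimately have "\<exists>Q. prime_chain (insert x I) (n + length xs) Q"
    using prime_chain_insert by blast
  then obtain Q where "prime_chain (insert x I) (n + length xs) Q" by blast
  then have "\<exists>Q. prime_chain (insert x I \<union> set xs) n Q" using Cons.prems by (intro Cons.IH) auto
  then show ?case by simp
qed

text \<open>A longer chain would leave, after dropping one step per element, a chain of positive
  length over \<open>I \<union> set xs\<close>, where the maximal ideal is the only
  candidate.\<close>

lemma prime_chain_length_le:
  fixes xs :: "'a::comm_ring_1 list"
  assumes loc: "noetherian_local_ring TYPE('a)" and xs: "set xs \<subseteq> max_ideal"
    and only: "\<And>p. prime_ideal p \<Longrightarrow> I \<union> set xs \<subseteq> p \<Longrightarrow> p = max_ideal"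
    and ch: "prime_chain I n P"
  shows "n \<le> length xs"
proof (rule ccontr)
  assume "\<not> n \<le> length xs"
  then have n: "n = (n - length xs) + length xs" "n - length xs > 0" by simp_all
  obtain Q where Q: "prime_chain (I \<union> set xs) (n - length xs) Q"
    using prime_chain_drop[OF loc _ xs] ch n(1) by metis
  then have "Q 0 \<subset> Q (Suc 0)" "Q 0 = max_ideal" "Q (Suc 0) = max_ideal"
    using n(2) only by (auto simp: prime_chain_def)
  then show False by blast
qed

text \<open>A longest chain over \<open>I\<close> loses at most one step per entry of
  \<open>xs\<close>, which is the lower bound; the upper bound holds because \<open>zs\<close> cuts
  the remaining primes down to the maximal ideal.\<close>

lemma krull_dim_parameters:
  fixes xs zs :: "'a::comm_ring_1 list"
  assumes loc: "noetherian_local_ring TYPE('a)"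
    and dim: "krull_dim I = enat (length zs + length xs)" "length zs + length xs > 0"
    and max: "set zs \<union> set xs \<subseteq> max_ideal"
    and only: "\<And>p. prime_ideal p \<Longrightarrow> I \<union> set xs \<union> set zs \<subseteq> p \<Longrightarrow> p = max_ideal"
  shows "krull_dim (I \<union> set xs) = enat (length zs)"
proof -
  obtain P where "prime_chain I (length zs + length xs) P" using krull_dim_attained[OF dim] by blast
  then obtain Q where "prime_chain (I \<union> set xs) (length zs) Q"
    using prime_chain_drop[OF loc] max by blast
  moreover have "k \<le> length zs" if "prime_chain (I \<union> set xs) k P" for k P
    by (rule prime_chain_length_le[OF loc _ _ that]) (use max only in auto)
  ultimately show ?thesis by (rule krull_dim_eqI)
qed

section \<open>The submodules X M\<close>

context noetherian_module
begin

text \<open>By \<open>quot_bot_smult_span\<close> all the bottom submodules in the definitions take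
  this form, so sequences of parameters can be treated as sets, without their order and without the
  ideal they generate.\<close>

definition smult_span :: "'a set \<Rightarrow> 'm set" where
  "smult_span X = span {r *s v |r v. r \<in> X}"

lemma subspace_smult_span: "subspace (smult_span X)"
  by (simp add: smult_span_def)

lemma smult_span_empty [simp]: "smult_span {} = {0}"
  by (simp add: smult_span_def)

lemma smult_span_mono: "X \<subseteq> Y \<Longrightarrow> smult_span X \<subseteq> smult_span Y"
  unfolding smult_span_def by (intro span_mono) auto

lemma smult_in_smult_span: "r \<in> X \<Longrightarrow> r *s v \<in> smult_span X"
  unfolding smult_span_def by (intro span_base) blast

lemma smult_span_least: "subspace N \<Longrightarrow> (\<And>r v. r \<in> X \<Longrightarrow> r *s v \<in> N) \<Longrightarrow> smult_span X \<subseteq> N"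
  unfolding smult_span_def by (intro span_minimal) auto

lemma ideal_times_UNIV: "ideal_times scale (ideal_gen X) UNIV = smult_span X"
proof
  have "ideal_gen X \<subseteq> ann scale UNIV (smult_span X)"
    using smult_in_smult_span
    by (intro ideal_gen_least is_ideal_ann subspace_smult_span) (auto simp: ann_def)
  then show "ideal_times scale (ideal_gen X) UNIV \<subseteq> smult_span X"
    unfolding ideal_times_def submod_gen_eq_span
    by (intro span_minimal) (auto simp: subspace_smult_span ann_def)
  show "smult_span X \<subseteq> ideal_times scale (ideal_gen X) UNIV"
    unfolding ideal_times_def submod_gen_eq_span smult_span_def
    using ideal_gen_superset[of X] by (intro span_mono) blast
qed

lemma quot_bot_smult_span: "quot_bot scale zs UNIV (smult_span X) = smult_span (X \<union> set zs)"
proof -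
  have "{r *s v |r v. r \<in> X \<union> set zs} = {r *s v |r v. r \<in> X} \<union> {r *s v |r v. r \<in> set zs}" by blast
  then show ?thesis
    by (simp add: quot_bot_def ideal_times_UNIV msum_def smult_span_def span_Un)
qed

lemma quot_bot_zero: "quot_bot scale zs UNIV {0} = smult_span (set zs)"
  using quot_bot_smult_span[of zs "{}"] by simp

lemma smult_span_insert: "smult_span (insert x X) = {k + x *s v |k v. k \<in> smult_span X}"
proof -
  have "{r *s v |r v. r \<in> insert x X} = {r *s v |r v. r \<in> X} \<union> range (scale x)" by blast
  moreover have "subspace (range (scale x))"
  proof (rule subspaceI)
    show "0 \<in> range (scale x)" by (rule range_eqI[of _ _ 0]) simp
  next
    fix a b assume "a \<in> range (scale x)" "b \<in> range (scale x)"
    then show "a + b \<in> range (scale x)" by (auto simp flip: scale_right_distrib)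
  next
    fix c a assume "a \<in> range (scale x)"
    then obtain v where "a = x *s v" by blast
    then show "c *s a \<in> range (scale x)" by (intro range_eqI[of _ _ "c *s v"]) (simp add: mult.commute)
  qed
  then have "span (range (scale x)) = range (scale x)"
    by (rule span_subspace[OF order_refl span_superset])
  ultimately have "smult_span (insert x X) = {a + b |a b. a \<in> smult_span X \<and> b \<in> range (scale x)}"
    by (simp only: smult_span_def span_Un)
  then show ?thesis by blast
qed

end

section \<open>Support and finite length of M / X M over a local ring\<close>

locale local_noetherian_module = noetherian_module scale
  for scale :: "'a::comm_ring_1 \<Rightarrow> 'm::ab_group_add \<Rightarrow> 'm" (infixr \<open>*s\<close> 75) +
  assumes local_ring: "noetherian_local_ring TYPE('a)"
begin

text \<open>The prime ideal form of \<open>M / X M\<close> having finite length; the two are shown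
  equivalent below.\<close>

definition supported_at_max :: "'a set \<Rightarrow> bool" where
  "supported_at_max X \<longleftrightarrow> (\<forall>p. prime_ideal p \<longrightarrow> ann scale UNIV {0} \<union> X \<subseteq> p \<longrightarrow> p = max_ideal)"

text \<open>The support of \<open>M / X M\<close> is cut out by \<open>X\<close> in the support of
  \<open>M\<close>. For the harder direction, an \<open>r\<close> outside \<open>p\<close> with
  \<open>r M\<close> inside \<open>X M\<close>, hence inside \<open>p M\<close>, yields by
  Nakayama's lemma some \<open>t\<close> outside \<open>p\<close> that kills
  \<open>M\<close>.\<close>

lemma ann_smult_span_subset_iff:
  assumes p: "prime_ideal p"
  shows "ann scale UNIV (smult_span X) \<subseteq> p \<longleftrightarrow> ann scale UNIV {0} \<union> X \<subseteq> p"
proof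
  have "ann scale UNIV {0} \<union> X \<subseteq> ann scale UNIV (smult_span X)"
    using smult_in_smult_span subspace_0[OF subspace_smult_span] by (auto simp: ann_def)
  then show "ann scale UNIV (smult_span X) \<subseteq> p \<Longrightarrow> ann scale UNIV {0} \<union> X \<subseteq> p" by blast
next
  assume le: "ann scale UNIV {0} \<union> X \<subseteq> p"
  have pI: "is_ideal p" by (rule prime_ideal_is_ideal[OF p])
  obtain G where G: "finite G" "UNIV = span G" using fg_subspace[OF subspace_UNIV] by blast
  \<comment> \<open>This is \<open>p M\<close>, in a form that hands over coefficients in
    \<open>p\<close> with respect to \<open>G\<close>.\<close>
  define T where "T = {\<Sum>h\<in>G. c h *s h |c. \<forall>h\<in>G. c h \<in> p}"
  have T_I: "(\<And>h. h \<in> G \<Longrightarrow> c h \<in> p) \<Longrightarrow> (\<Sum>h\<in>G. c h *s h) \<in> T" for c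
    unfolding T_def by blast
  have "smult_span X \<subseteq> T"
  proof (rule smult_span_least)
    show "subspace T"
    proof (rule subspaceI)
      show "0 \<in> T" using T_I[of "\<lambda>_. 0"] is_ideal_zero[OF pI] by simp
    next
      fix x y assume "x \<in> T" "y \<in> T"
      then obtain c d where "\<forall>h\<in>G. c h \<in> p" "x = (\<Sum>h\<in>G. c h *s h)"
        "\<forall>h\<in>G. d h \<in> p" "y = (\<Sum>h\<in>G. d h *s h)" unfolding T_def by blast
      then show "x + y \<in> T"
        using T_I[of "\<lambda>h. c h + d h"] is_ideal_add[OF pI] by (simp add: scale_left_distrib sum.distrib)
    next
      fix r x assume "x \<in> T"
      then obtain c where "\<forall>h\<in>G. c h \<in> p" "x = (\<Sum>h\<in>G. c h *s h)" unfolding T_def by blast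
      then show "r *s x \<in> T"
        using T_I[of "\<lambda>h. r * c h"] is_ideal_mult[OF pI] by (simp add: scale_sum_right)
    qed
  next
    fix r v assume "r \<in> X"
    then have "r \<in> p" using le by blast
    moreover have "v \<in> span G" using G by blast
    then obtain u where "v = (\<Sum>h\<in>G. u h *s h)" by (auto simp: span_finite[OF G(1)])
    ultimately show "r *s v \<in> T"
      using T_I[of "\<lambda>h. r * u h"] is_ideal_mult_right[OF pI] by (simp add: scale_sum_right)
  qed
  show "ann scale UNIV (smult_span X) \<subseteq> p"
  proof
    fix r assume r: "r \<in> ann scale UNIV (smult_span X)"
    show "r \<in> p"
    proof (rule ccontr)
      assume rp: "r \<notin> p"
      have "\<exists>t. t \<notin> p \<and> (\<forall>g\<in>G. t *s g \<in> {0})"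
      proof (rule nakayama_at_prime[OF p subspace_single_0 G(1)])
        fix g
        have "r *s g \<in> T" using r \<open>smult_span X \<subseteq> T\<close> by (auto simp: ann_def)
        then obtain c where "\<forall>h\<in>G. c h \<in> p" "r *s g = (\<Sum>h\<in>G. c h *s h)" unfolding T_def by blast
        then show "\<exists>r c. r \<notin> p \<and> (\<forall>h\<in>G. c h \<in> p) \<and> r *s g - (\<Sum>h\<in>G. c h *s h) \<in> {0}"
          using rp by (intro exI[of _ r] exI[of _ c]) simp
      qed
      then obtain t where t: "t \<notin> p" "\<And>g. g \<in> G \<Longrightarrow> t *s g = 0" by blast
      have "t *s v = 0" for v
      proof -
        have "v \<in> span G" using G by blast
        then obtain u where "v = (\<Sum>h\<in>G. u h *s h)" by (auto simp: span_finite[OF G(1)])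
        then have "t *s v = (\<Sum>h\<in>G. u h *s (t *s h))" by (simp add: scale_sum_right mult.commute)
        then show ?thesis using t(2) by simp
      qed
      then have "t \<in> ann scale UNIV {0}" by (simp add: ann_def)
      then show False using le t(1) by blast
    qed
  qed
qed

text \<open>The local bound is applied at the maximal ideal, where every submodule is saturated
  because the elements outside are units.\<close>

lemma finite_length_smult_span:
  assumes "supported_at_max X"
  shows "mlength scale UNIV (smult_span X) < \<infinity>"
proof -
  have "\<exists>b. \<forall>n N. sat_chain scale max_ideal (smult_span X) n N \<longrightarrow> n \<le> b"
  proof (rule local_length_bounded[OF prime_max_ideal[OF local_ring] subspace_smult_span])
    fix q assume "prime_ideal q" "{r. \<forall>v. r *s v \<in> smult_span X} \<subseteq> q"
    moreover from this have "ann scale UNIV {0} \<union> X \<subseteq> q"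
      using ann_smult_span_subset_iff[of q X] by (simp add: ann_def)
    ultimately show "q = max_ideal" using assms by (simp add: supported_at_max_def)
  qed
  then obtain b where b: "\<And>n N. sat_chain scale max_ideal (smult_span X) n N \<Longrightarrow> n \<le> b" by blast
  have sat: "saturated scale max_ideal N" if "subspace N" for N
    unfolding saturated_def
  proof (intro allI impI)
    fix r v assume r: "r \<notin> max_ideal" "r *s v \<in> N"
    obtain u where "u * r = 1" using unit_outside_max_ideal[OF local_ring r(1)] by blast
    then have "u *s (r *s v) = v" by simp
    then show "v \<in> N" using subspace_scale[OF that r(2), of u] by simp
  qed
  have "n \<le> b" if N: "N 0 = smult_span X" "\<forall>i\<le>n. submod scale (N i)" "\<forall>i<n. N i \<subset> N (Suc i)" for n N
  proof (rule b)
    have "i \<le> n \<Longrightarrow> smult_span X \<subseteq> N i" for i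
    proof (induction i)
      case (Suc i)
      then have "N i \<subset> N (Suc i)" using N(3) by simp
      then show ?case using Suc by auto
    qed (simp add: N(1))
    then show "sat_chain scale max_ideal (smult_span X) n N"
      using N sat by (simp add: sat_chain_def submod_eq_subspace)
  qed
  then have "mlength scale UNIV (smult_span X) \<le> enat b"
    unfolding mlength_def by (intro Sup_least) auto
  then show ?thesis using enat_ord_code(4) order_le_less_trans by blast
qed

text \<open>For another prime \<open>p\<close> of the support take a non-unit \<open>r\<close>
  outside \<open>p\<close>. The submodules \<open>r ^ k M + X M\<close> descend strictly forever,
  since equality of two neighbours would put \<open>r ^ k\<close> into the annihilator of
  \<open>M / X M\<close>, hence into \<open>p\<close>.\<close>

lemma supported_at_max_if_finite_length:
  assumes fin: "mlength scale UNIV (smult_span X) < \<infinity>"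
  shows "supported_at_max X"
  unfolding supported_at_max_def
proof (intro allI impI, rule ccontr)
  fix p assume p: "prime_ideal p" "ann scale UNIV {0} \<union> X \<subseteq> p" "p \<noteq> max_ideal"
  let ?K = "smult_span X"
  have "p \<subset> max_ideal" using p prime_subset_max_ideal[OF local_ring] by blast
  then obtain r where r: "r \<in> max_ideal" "r \<notin> p" by blast
  have annp: "ann scale UNIV ?K \<subseteq> p" using ann_smult_span_subset_iff[OF p(1)] p(2) by blast
  define R where "R k = smult_span (insert (r ^ k) X)" for k
  have R: "R k = {a + r ^ k *s v |a v. a \<in> ?K}" for k unfolding R_def by (rule smult_span_insert)
  have KR: "?K \<subseteq> R k" for k unfolding R_def by (intro smult_span_mono) blast
  have R_dec: "R (Suc k) \<subseteq> R k" for k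
  proof
    fix w assume "w \<in> R (Suc k)"
    then obtain a v where "a \<in> ?K" "w = a + r ^ Suc k *s v" unfolding R by blast
    then have "w = a + r ^ k *s (r *s v)" by (simp add: mult.commute)
    then show "w \<in> R k" unfolding R using \<open>a \<in> ?K\<close> by blast
  qed
  have R_neq: "R (Suc k) \<noteq> R k" for k
  proof
    assume eq: "R (Suc k) = R k"
    obtain G where G: "finite G" "UNIV = span G" using fg_subspace[OF subspace_UNIV] by blast
    \<comment> \<open>Equality of the neighbours says that the whole module is
      \<open>N + r M\<close>; Nakayama's lemma then gives \<open>N = UNIV\<close>.\<close>
    define N where "N = {v. r ^ k *s v \<in> ?K}"
    have N: "subspace N"
      unfolding N_def
      using subspace_0[OF subspace_smult_span] subspace_add[OF subspace_smult_span]
        subspace_scale[OF subspace_smult_span, of "r ^ k *s _"]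
      by (auto simp: subspace_def scale_right_distrib mult.commute)
    have "\<exists>t. t \<notin> max_ideal \<and> (\<forall>g\<in>G. t *s g \<in> N)"
    proof (rule nakayama_at_prime[OF prime_max_ideal[OF local_ring] N G(1)])
      fix g
      have "0 + r ^ k *s g \<in> R k" unfolding R using subspace_0[OF subspace_smult_span] by blast
      then obtain a v where av: "a \<in> ?K" "r ^ k *s g = a + r ^ Suc k *s v"
        unfolding eq[symmetric] unfolding R by auto
      have "v \<in> span G" using G by blast
      then obtain u where u: "v = (\<Sum>h\<in>G. u h *s h)" by (auto simp: span_finite[OF G(1)])
      have "r ^ k *s (g - r *s v) = a"
        using av by (simp add: scale_right_diff_distrib mult.commute)
      then have "1 *s g - (\<Sum>h\<in>G. (r * u h) *s h) \<in> N"
        using av by (simp add: N_def u scale_sum_right)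
      then show "\<exists>t c. t \<notin> max_ideal \<and> (\<forall>h\<in>G. c h \<in> max_ideal) \<and> t *s g - (\<Sum>h\<in>G. c h *s h) \<in> N"
        using prime_ideal_one[OF prime_max_ideal[OF local_ring]]
          is_ideal_mult_right[OF is_ideal_max_ideal[OF local_ring] r(1)]
        by (intro exI[of _ 1] exI[of _ "\<lambda>h. r * u h"]) blast
    qed
    then obtain t where t: "t \<notin> max_ideal" "\<And>g. g \<in> G \<Longrightarrow> t *s g \<in> N" by blast
    obtain u where "u * t = 1" using unit_outside_max_ideal[OF local_ring t(1)] by blast
    then have "u *s (t *s g) = g" for g by simp
    then have "G \<subseteq> N" using subspace_scale[OF N t(2)] by (metis subsetI)
    then have "span G \<subseteq> N" using N by (rule span_minimal)
    then have "N = UNIV" using G by blast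
    then have "r ^ k \<in> ann scale UNIV ?K" by (auto simp: N_def ann_def)
    then show False using annp r prime_ideal_power[OF p(1)] by blast
  qed
  have strict: "R (Suc k) \<subset> R k" for k using R_dec R_neq by blast
  have "enat n \<le> mlength scale UNIV ?K" for n
  proof -
    \<comment> \<open>A chain counted by \<open>mlength\<close> has to start at the bottom submodule
      itself, which therefore takes the place of \<open>R n\<close>; the first step stays strict
      because \<open>R n\<close> is strictly below \<open>R (n - 1)\<close>.\<close>
    define N where "N i = (if i = 0 then ?K else R (n - i))" for i
    have "R 0 = UNIV" unfolding R using subspace_0[OF subspace_smult_span] by force
    moreover have "N i \<subset> N (Suc i)" if "i < n" for i
      using strict[of "n - Suc i"] KR[of "Suc (n - Suc i)"] that by (auto simp: N_def Suc_diff_Suc)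
    moreover have "submod scale (N i)" for i
      by (simp add: N_def R_def submod_eq_subspace subspace_smult_span)
    ultimately have "n > 0 \<Longrightarrow> N 0 = ?K \<and> N n = UNIV \<and> (\<forall>i\<le>n. submod scale (N i)) \<and> (\<forall>i<n. N i \<subset> N (Suc i))"
      by (simp add: N_def)
    then have "n > 0 \<Longrightarrow> enat n \<le> mlength scale UNIV ?K"
      unfolding mlength_def by (intro Sup_upper) blast
    then show ?thesis by (cases n) (auto simp: zero_enat_def[symmetric])
  qed
  moreover obtain b where "mlength scale UNIV ?K = enat b" using fin by auto
  ultimately have "enat (Suc b) \<le> enat b" by metis
  then show False by simp
qed

lemma mdim_smult_span: "mdim scale UNIV (smult_span X) = krull_dim (ann scale UNIV {0} \<union> X)"
  unfolding mdim_def by (intro krull_dim_cong ann_smult_span_subset_iff)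

text \<open>Supplies members of the family over which the \<open>bideal\<close> of a quotient is
  intersected: the tail \<open>xs\<close> is divided out and \<open>zs\<close> remains.\<close>

lemma sopI:
  assumes "mdim scale UNIV {0} = enat (length zs + length xs)" "length zs + length xs > 0"
    and "set zs \<union> set xs \<subseteq> max_ideal" "supported_at_max (set zs \<union> set xs)"
  shows "sop scale UNIV (smult_span (set xs)) zs"
  unfolding sop_def quot_bot_smult_span
proof (intro conjI)
  have "krull_dim (ann scale UNIV {0} \<union> set xs) = enat (length zs)"
    using assms by (intro krull_dim_parameters[OF local_ring])
      (auto simp: mdim_def supported_at_max_def)
  then show "mdim scale UNIV (smult_span (set xs)) = enat (length zs)" by (simp add: mdim_smult_span)
  show "mlength scale UNIV (smult_span (set xs \<union> set zs)) < \<infinity>"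
    using assms(4) by (intro finite_length_smult_span) (simp add: Un_commute)
qed (use assms in simp)

lemma sop_supported: "sop scale UNIV {0} xs \<Longrightarrow> supported_at_max (set xs)"
  by (intro supported_at_max_if_finite_length) (simp add: sop_def quot_bot_zero)

end


section \<open>Exchanging one parameter\<close>

lemma is_ideal_ideal_prod: "is_ideal (ideal_prod I J)"
  by (simp add: ideal_prod_def is_ideal_ideal_gen)

lemma ideal_prod_subset_left: "is_ideal I \<Longrightarrow> ideal_prod I J \<subseteq> I"
  unfolding ideal_prod_def by (rule ideal_gen_least) (auto intro: is_ideal_mult_right)

lemma mult_in_ideal_prod: "a \<in> I \<Longrightarrow> b \<in> J \<Longrightarrow> a * b \<in> ideal_prod I J"
  unfolding ideal_prod_def by (intro subsetD[OF ideal_gen_superset]) blast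

text \<open>With a list of pairs, repetitions are harmless and addition is concatenation; closure of
  \<open>I\<close> under multiples absorbs scalars into the first components.\<close>

lemma ideal_prod_sum_list:
  assumes I: "is_ideal I" and x: "x \<in> ideal_prod I J"
  shows "\<exists>l. set l \<subseteq> I \<times> J \<and> x = (\<Sum>(u, w)\<leftarrow>l. u * w)"
proof -
  define T where "T = {\<Sum>(u, w)\<leftarrow>l. u * w |l. set l \<subseteq> I \<times> J}"
  have T_I: "set l \<subseteq> I \<times> J \<Longrightarrow> (\<Sum>(u, w)\<leftarrow>l. u * w) \<in> T" for l unfolding T_def by blast
  have "is_ideal T"
    unfolding is_ideal_def
  proof (intro conjI ballI allI)
    show "0 \<in> T" using T_I[of "[]"] by simp
  next
    fix a b assume "a \<in> T" "b \<in> T"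
    then obtain l l' where "set l \<subseteq> I \<times> J" "a = (\<Sum>(u, w)\<leftarrow>l. u * w)"
      "set l' \<subseteq> I \<times> J" "b = (\<Sum>(u, w)\<leftarrow>l'. u * w)" unfolding T_def by blast
    then show "a + b \<in> T" using T_I[of "l @ l'"] by simp
  next
    fix r a assume "a \<in> T"
    then obtain l where l: "set l \<subseteq> I \<times> J" "a = (\<Sum>(u, w)\<leftarrow>l. u * w)" unfolding T_def by blast
    have "set (map (\<lambda>(u, w). (r * u, w)) l) \<subseteq> I \<times> J" using l(1) is_ideal_mult[OF I] by auto
    moreover have "(\<Sum>(u, w)\<leftarrow>map (\<lambda>(u, w). (r * u, w)) l. u * w) = r * a"
      unfolding l(2) by (induction l) (auto simp: algebra_simps)
    ultimately show "r * a \<in> T" using T_I by metis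
  qed
  moreover have "{a * b |a b. a \<in> I \<and> b \<in> J} \<subseteq> T"
  proof
    fix c assume "c \<in> {a * b |a b. a \<in> I \<and> b \<in> J}"
    then obtain a b where "a \<in> I" "b \<in> J" "c = a * b" by blast
    then show "c \<in> T" using T_I[of "[(a, b)]"] by simp
  qed
  ultimately have "ideal_prod I J \<subseteq> T" unfolding ideal_prod_def by (rule ideal_gen_least)
  then show ?thesis using x unfolding T_def by blast
qed

text \<open>The graph of an isomorphism between \<open>V / K\<close> and \<open>V' / K'\<close>. A
  relation accommodates maps that depend on choices; \<open>kernel\<close> expresses at once that
  the map is well defined and that it is injective.\<close>

locale linear_relation = module scale
  for scale :: "'a::comm_ring_1 \<Rightarrow> 'm::ab_group_add \<Rightarrow> 'm" (infixr \<open>*s\<close> 75) +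
  fixes \<Gamma> :: "'m \<Rightarrow> 'm \<Rightarrow> bool" and V V' K K' :: "'m set"
  assumes zero: "\<Gamma> 0 0"
    and add: "\<Gamma> v v' \<Longrightarrow> \<Gamma> w w' \<Longrightarrow> \<Gamma> (v + w) (v' + w')"
    and scaled: "\<Gamma> v v' \<Longrightarrow> \<Gamma> (r *s v) (r *s v')"
    and left_total: "v \<in> V \<Longrightarrow> \<exists>v'\<in>V'. \<Gamma> v v'"
    and right_total: "v' \<in> V' \<Longrightarrow> \<exists>v\<in>V. \<Gamma> v v'"
    and kernel: "\<Gamma> v v' \<Longrightarrow> v \<in> K \<longleftrightarrow> v' \<in> K'"
    and zero_mem: "0 \<in> K"
begin

lemma related_sum:
  "finite B \<Longrightarrow> (\<And>b. b \<in> B \<Longrightarrow> \<Gamma> (f b) (g b)) \<Longrightarrow> \<Gamma> (\<Sum>b\<in>B. c b *s f b) (\<Sum>b\<in>B. c b *s g b)"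
  by (induction B rule: finite_induct) (simp_all add: zero add scaled)

lemma k_basis_transfer:
  assumes one: "1 \<notin> (max_ideal :: 'a set)" and B: "k_basis scale V K B"
  shows "\<exists>B'. k_basis scale V' K' B' \<and> card B' = card B"
proof -
  have fin: "finite B" and BV: "B \<subseteq> V"
    and spans: "\<And>v. v \<in> V \<Longrightarrow> \<exists>f. v - (\<Sum>b\<in>B. f b *s b) \<in> K"
    and indep: "\<And>f b. (\<Sum>b\<in>B. f b *s b) \<in> K \<Longrightarrow> b \<in> B \<Longrightarrow> f b \<in> max_ideal"
    using B by (auto simp: k_basis_def)
  have "\<forall>b\<in>B. \<exists>b'\<in>V'. \<Gamma> b b'" using BV left_total by blast
  then obtain g where g: "\<And>b. b \<in> B \<Longrightarrow> g b \<in> V'" "\<And>b. b \<in> B \<Longrightarrow> \<Gamma> b (g b)" by metis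
  have rel: "\<Gamma> (\<Sum>b\<in>B. c b *s b) (\<Sum>b\<in>B. c b *s g b)" for c
    using related_sum[OF fin, of "\<lambda>b. b" g c] g(2) by simp
  have inj: "inj_on g B"
  proof (rule inj_onI, rule ccontr)
    fix a b assume ab: "a \<in> B" "b \<in> B" "g a = g b" "a \<noteq> b"
    \<comment> \<open>The coefficients of \<open>a - b\<close>. A common image would relate this
      combination to 0 and force the coefficient 1 into the maximal ideal.\<close>
    define c where "c e = (if e = a then 1 else if e = b then - 1 else 0 :: 'a)" for e
    have c_sum: "(\<Sum>e\<in>B. c e *s f e) = f a - f b" for f
    proof -
      have "(\<Sum>e\<in>B. c e *s f e) = (\<Sum>e\<in>{a, b}. c e *s f e)"
        using ab fin by (intro sum.mono_neutral_right) (auto simp: c_def)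
      then show ?thesis using ab by (simp add: c_def)
    qed
    have "\<Gamma> (\<Sum>e\<in>B. c e *s e) 0" using rel[of c] ab by (simp add: c_sum)
    then have "(\<Sum>e\<in>B. c e *s e) \<in> K" using kernel[OF zero] kernel zero_mem by blast
    then have "c a \<in> max_ideal" using indep ab by blast
    then show False using one by (simp add: c_def)
  qed
  have "k_basis scale V' K' (g ` B)"
    unfolding k_basis_def
  proof (intro conjI ballI allI impI)
    fix v' assume "v' \<in> V'"
    then obtain v where v: "v \<in> V" "\<Gamma> v v'" using right_total by blast
    then obtain f where f: "v - (\<Sum>b\<in>B. f b *s b) \<in> K" using spans by blast
    have "\<Gamma> (v + (- 1) *s (\<Sum>b\<in>B. f b *s b)) (v' + (- 1) *s (\<Sum>b\<in>B. f b *s g b))"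
      by (intro add scaled v rel)
    then have "v' - (\<Sum>b\<in>B. f b *s g b) \<in> K'" using f kernel by simp
    moreover have "(\<Sum>b\<in>g ` B. f (inv_into B g b) *s b) = (\<Sum>b\<in>B. f b *s g b)"
      using inj by (simp add: sum.reindex)
    ultimately show "\<exists>f. v' - (\<Sum>b\<in>g ` B. f b *s b) \<in> K'" by metis
  next
    fix f b' assume "(\<Sum>b\<in>g ` B. f b *s b) \<in> K'" "b' \<in> g ` B"
    then obtain b where b: "b \<in> B" "b' = g b" and "(\<Sum>b\<in>B. f (g b) *s g b) \<in> K'"
      using inj by (auto simp: sum.reindex)
    then have "(\<Sum>b\<in>B. f (g b) *s b) \<in> K" using kernel[OF rel[of "\<lambda>b. f (g b)"]] by simp
    then show "f b' \<in> max_ideal" using indep[of "\<lambda>b. f (g b)"] b by simp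
  qed (use fin g in auto)
  then show ?thesis using card_image[OF inj] by blast
qed

end

text \<open>The hypotheses are symmetric in the two sides, so bases of each cardinality correspond;
  the two least numbers then agree, whether or not a basis exists.\<close>

lemma (in linear_relation) k_dim_eq:
  assumes one: "1 \<notin> (max_ideal :: 'a set)"
  shows "k_dim scale V K = k_dim scale V' K'"
proof -
  interpret converse: linear_relation scale "\<lambda>v v'. \<Gamma> v' v" V' V K' K
    using zero add scaled left_total right_total kernel zero_mem kernel[OF zero]
    by unfold_locales auto
  have "(\<exists>B. k_basis scale V K B \<and> card B = n) \<longleftrightarrow> (\<exists>B. k_basis scale V' K' B \<and> card B = n)" for n
    using k_basis_transfer[OF one] converse.k_basis_transfer[OF one] by metis
  then show ?thesis by (simp add: k_dim_def)
qed

section \<open>Comparison of socles in dimension one\<close>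

context noetherian_module
begin

text \<open>The submodule \<open>K + x M\<close> as a congruence, so that membership supplies the
  cofactor \<open>q\<close>.\<close>

definition plus_multiples :: "'m set \<Rightarrow> 'a \<Rightarrow> 'm set" where
  "plus_multiples K x = {z. \<exists>q. z - x *s q \<in> K}"

lemma smult_span_insert_plus_multiples: "smult_span (insert x X) = plus_multiples (smult_span X) x"
proof -
  have "(\<exists>k v. z = k + x *s v \<and> k \<in> smult_span X) \<longleftrightarrow> (\<exists>q. z - x *s q \<in> smult_span X)" for z
    by (metis add_diff_cancel_right' diff_add_cancel)
  then show ?thesis by (simp add: smult_span_insert plus_multiples_def)
qed

text \<open>The one-dimensional case. Let \<open>W/K\<close> be the part of the quotient by \<open>K\<close> killed by powers of
  \<open>x y\<close>. On the quotient by \<open>W\<close>, multiplication by \<open>y\<close> identifies the socles modulo \<open>x\<close> and modulo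
  \<open>x y\<close>, since both elements are regular there. As \<open>x = \<Sum> u w\<close> with each \<open>w\<close> killing \<open>W/K\<close>,
  a socle element \<open>v\<close> with \<open>u v = x n\<^sub>u\<close> modulo \<open>W\<close> splits into \<open>\<theta> n = \<Sum> w n\<^sub>u\<close>, well
  defined modulo \<open>K\<close>, and the rest, which lies in \<open>W\<close>. The relation \<open>\<Gamma>\<close> multiplies the first part by
  \<open>y\<close> and fixes the second.\<close>

lemma socle_dim_mult:
  assumes K: "subspace K" and one: "1 \<notin> (max_ideal :: 'a set)"
    and l: "set l \<subseteq> max_ideal \<times> A" "x = (\<Sum>(u, w)\<leftarrow>l. u * w)"
    and kills: "\<And>c n v. c \<in> A \<Longrightarrow> (x * y) ^ n *s v \<in> K \<Longrightarrow> c *s v \<in> K"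
  shows "k_dim scale (socle scale UNIV (plus_multiples K x)) (plus_multiples K x) =
    k_dim scale (socle scale UNIV (plus_multiples K (x * y))) (plus_multiples K (x * y))"
proof -
  define W where "W = {v. \<exists>n. (x * y) ^ n *s v \<in> K}"
  have W: "subspace W"
  proof (rule subspaceI)
    have "(x * y) ^ 0 *s 0 \<in> K" using subspace_0[OF K] by simp
    then show "0 \<in> W" unfolding W_def by blast
  next
    fix a b assume "a \<in> W" "b \<in> W"
    then obtain m n where "(x * y) ^ m *s a \<in> K" "(x * y) ^ n *s b \<in> K" by (auto simp: W_def)
    then have "(x * y) ^ n *s ((x * y) ^ m *s a) + (x * y) ^ m *s ((x * y) ^ n *s b) \<in> K"
      by (simp only: subspace_add[OF K] subspace_scale[OF K])
    then have "(x * y) ^ (m + n) *s (a + b) \<in> K"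
      by (simp only: power_add scale_scale scale_right_distrib mult.commute)
    then show "a + b \<in> W" unfolding W_def by blast
  next
    fix c a assume "a \<in> W"
    then obtain n where "(x * y) ^ n *s a \<in> K" by (auto simp: W_def)
    then have "c *s ((x * y) ^ n *s a) \<in> K" by (rule subspace_scale[OF K])
    then have "(x * y) ^ n *s (c *s a) \<in> K" by (simp only: scale_scale mult.commute)
    then show "c *s a \<in> W" unfolding W_def by blast
  qed
  have KW: "a \<in> W" if "a \<in> K" for a
  proof -
    have "(x * y) ^ 0 *s a \<in> K" using that by simp
    then show ?thesis unfolding W_def by blast
  qed
  have A_W: "c *s a \<in> K" if "c \<in> A" "a \<in> W" for c a using that kills by (auto simp: W_def)
  have W_mult: "a \<in> W" if "(x * y) *s a \<in> W" for a
  proof -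
    obtain n where "(x * y) ^ n *s ((x * y) *s a) \<in> K" using \<open>(x * y) *s a \<in> W\<close> by (auto simp: W_def)
    then have "(x * y) ^ Suc n *s a \<in> K" by (simp only: scale_scale power_Suc2)
    then show ?thesis unfolding W_def by blast
  qed
  have W_x: "a \<in> W" if "x *s a \<in> W" for a
  proof -
    have "y *s (x *s a) \<in> W" by (rule subspace_scale[OF W that])
    then show ?thesis using W_mult by (simp add: mult.commute)
  qed
  have W_y: "a \<in> W" if "y *s a \<in> W" for a
  proof -
    have "x *s (y *s a) \<in> W" by (rule subspace_scale[OF W that])
    then show ?thesis using W_mult by simp
  qed

  \<comment> \<open>If \<open>u v = x n_u\<close> modulo \<open>W\<close> for all \<open>u\<close>,
    then \<open>x \<theta> n\<close> is \<open>\<Sum> w u v = x v\<close> modulo \<open>W\<close>;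
    cancelling \<open>x\<close> shows that \<open>\<theta> n\<close> recovers \<open>v\<close> up to
    \<open>W\<close>.\<close>
  define \<theta> where "\<theta> n = (\<Sum>(u, w)\<leftarrow>l. w *s n u)" for n :: "'a \<Rightarrow> 'm"
  have \<theta>_add: "\<theta> (\<lambda>u. n u + n' u) = \<theta> n + \<theta> n'" for n n'
    unfolding \<theta>_def by (induction l) (auto simp: scale_right_distrib)
  have \<theta>_scale: "\<theta> (\<lambda>u. r *s n u) = r *s \<theta> n" for r n
    unfolding \<theta>_def by (induction l) (auto simp: scale_right_distrib mult.commute)
  have \<theta>_mult: "\<theta> (\<lambda>u. u *s v) = x *s v" for v
    unfolding \<theta>_def l(2) by (induction l) (auto simp: scale_left_distrib mult.commute)
  have \<theta>_diff: "\<theta> n - \<theta> n' \<in> L"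
    if L: "subspace L" and "\<And>u w. (u, w) \<in> set l \<Longrightarrow> w *s (n u - n' u) \<in> L" for n n' L
    using that(2) unfolding \<theta>_def
  proof (induction l)
    case Nil
    then show ?case using subspace_0[OF L] by simp
  next
    case (Cons uw l)
    obtain u w where uw: "uw = (u, w)" by force
    have "w *s (n u - n' u) + ((\<Sum>(u, w)\<leftarrow>l. w *s n u) - (\<Sum>(u, w)\<leftarrow>l. w *s n' u)) \<in> L"
      using Cons uw by (intro subspace_add[OF L]) auto
    then show ?case by (simp add: uw algebra_simps)
  qed

  define lifts where "lifts v n \<longleftrightarrow> (\<forall>u w. (u, w) \<in> set l \<longrightarrow> u *s v - x *s n u \<in> W)" for v n
  \<comment> \<open>Each \<open>w\<close> sends \<open>W\<close> into \<open>K\<close>, so a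
    congruence for \<open>v\<close> modulo \<open>W\<close> becomes one for
    \<open>\<theta> n\<close> modulo \<open>K\<close>. The case \<open>r\<close> in the maximal
    ideal serves the socle conditions, the case \<open>r = 1\<close> the kernels.\<close>
  have \<theta>_rep: "r *s \<theta> n - x *s q \<in> K" if n: "lifts v n" and r: "r *s v - x *s q \<in> W" for v n r q
  proof -
    have "\<theta> (\<lambda>u. r *s n u) - \<theta> (\<lambda>u. u *s q) \<in> K"
    proof (rule \<theta>_diff[OF K])
      fix u w assume uw: "(u, w) \<in> set l"
      have "u *s v - x *s n u \<in> W" using n uw by (auto simp: lifts_def)
      then have "u *s (r *s v - x *s q) - r *s (u *s v - x *s n u) \<in> W"
        by (rule subspace_diff[OF W subspace_scale[OF W r] subspace_scale[OF W]])
      also have "u *s (r *s v - x *s q) - r *s (u *s v - x *s n u) = x *s (r *s n u - u *s q)"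
        by (simp add: algebra_simps)
      finally have "r *s n u - u *s q \<in> W" by (rule W_x)
      then show "w *s (r *s n u - u *s q) \<in> K" using uw l(1) A_W by blast
    qed
    then show ?thesis by (simp add: \<theta>_scale \<theta>_mult)
  qed
  have \<theta>_proj: "\<theta> n - v \<in> W" if n: "lifts v n" for v n
  proof -
    have "\<theta> (\<lambda>u. u *s v) - \<theta> (\<lambda>u. x *s n u) \<in> W"
      using n by (intro \<theta>_diff[OF W] subspace_scale[OF W]) (auto simp: lifts_def)
    then have "(- 1) *s (\<theta> (\<lambda>u. u *s v) - \<theta> (\<lambda>u. x *s n u)) \<in> W" by (rule subspace_scale[OF W])
    then have "x *s (\<theta> n - v) \<in> W" by (simp add: \<theta>_scale \<theta>_mult scale_right_diff_distrib)
    then show ?thesis by (rule W_x)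
  qed

  \<comment> \<open>The image of \<open>v\<close> is \<open>(v - \<theta> n) + y \<theta> n\<close>,
    whose first summand lies in \<open>W\<close>; \<open>q\<close> leaves it free up to multiples of
    \<open>x * y\<close>.\<close>
  define \<Gamma> where "\<Gamma> v v' \<longleftrightarrow>
    (\<exists>n q. lifts v n \<and> v' - (v + (y - 1) *s \<theta> n) - (x * y) *s q \<in> K)" for v v'
  have \<Gamma>_I: "\<Gamma> v v'" if "lifts v n" "v' - (v + (y - 1) *s \<theta> n) - (x * y) *s q \<in> K" for v v' n q
    using that unfolding \<Gamma>_def by blast
  have u_max: "u \<in> max_ideal" if "(u, w) \<in> set l" for u w using l(1) that by blast
  interpret linear_relation scale \<Gamma>
    "socle scale UNIV (plus_multiples K x)" "socle scale UNIV (plus_multiples K (x * y))"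
    "plus_multiples K x" "plus_multiples K (x * y)"
  proof unfold_locales
    have \<theta>0: "\<theta> (\<lambda>_. 0) = 0" using \<theta>_scale[of 0] by simp
    have "lifts 0 (\<lambda>_. 0)" using subspace_0[OF W] by (simp add: lifts_def)
    then show "\<Gamma> 0 0" using \<Gamma>_I[of 0 "\<lambda>_. 0" 0 0] subspace_0[OF K] by (simp add: \<theta>0)
    show "0 \<in> plus_multiples K x"
      using subspace_0[OF K] by (auto simp: plus_multiples_def intro: exI[of _ 0])
  next
    fix v v' w w' assume "\<Gamma> v v'" "\<Gamma> w w'"
    then obtain n q n' q' where *: "lifts v n" "v' - (v + (y - 1) *s \<theta> n) - (x * y) *s q \<in> K"
      "lifts w n'" "w' - (w + (y - 1) *s \<theta> n') - (x * y) *s q' \<in> K" unfolding \<Gamma>_def by blast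
    show "\<Gamma> (v + w) (v' + w')"
    proof (rule \<Gamma>_I[of _ "\<lambda>u. n u + n' u" _ "q + q'"])
      show "lifts (v + w) (\<lambda>u. n u + n' u)"
        unfolding lifts_def
      proof (intro allI impI)
        fix a c assume "(a, c) \<in> set l"
        then have "(a *s v - x *s n a) + (a *s w - x *s n' a) \<in> W"
          using * by (intro subspace_add[OF W]) (auto simp: lifts_def)
        then show "a *s (v + w) - x *s (n a + n' a) \<in> W" by (simp add: algebra_simps)
      qed
      have "(v' - (v + (y - 1) *s \<theta> n) - (x * y) *s q) + (w' - (w + (y - 1) *s \<theta> n') - (x * y) *s q') \<in> K"
        using * by (intro subspace_add[OF K])
      then show "v' + w' - (v + w + (y - 1) *s \<theta> (\<lambda>u. n u + n' u)) - (x * y) *s (q + q') \<in> K"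
        by (simp add: \<theta>_add algebra_simps)
    qed
  next
    fix v v' r assume "\<Gamma> v v'"
    then obtain n q where *: "lifts v n" "v' - (v + (y - 1) *s \<theta> n) - (x * y) *s q \<in> K"
      unfolding \<Gamma>_def by blast
    show "\<Gamma> (r *s v) (r *s v')"
    proof (rule \<Gamma>_I[of _ "\<lambda>u. r *s n u" _ "r *s q"])
      show "lifts (r *s v) (\<lambda>u. r *s n u)"
        unfolding lifts_def
      proof (intro allI impI)
        fix a c assume "(a, c) \<in> set l"
        then have "r *s (a *s v - x *s n a) \<in> W"
          using * by (intro subspace_scale[OF W]) (auto simp: lifts_def)
        then show "a *s (r *s v) - x *s (r *s n a) \<in> W" by (simp add: algebra_simps)
      qed
      have "r *s (v' - (v + (y - 1) *s \<theta> n) - (x * y) *s q) \<in> K"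
        using *(2) by (rule subspace_scale[OF K])
      then show "r *s v' - (r *s v + (y - 1) *s \<theta> (\<lambda>u. r *s n u)) - (x * y) *s (r *s q) \<in> K"
        by (simp add: \<theta>_scale algebra_simps)
    qed
  next
    fix v assume "v \<in> socle scale UNIV (plus_multiples K x)"
    then have v: "\<And>r. r \<in> max_ideal \<Longrightarrow> \<exists>q. r *s v - x *s q \<in> K"
      by (auto simp: socle_def plus_multiples_def)
    then obtain n where "\<And>u. u \<in> max_ideal \<Longrightarrow> u *s v - x *s n u \<in> K" by metis
    then have n: "lifts v n" using u_max KW by (auto simp: lifts_def)
    have "\<Gamma> v (v + (y - 1) *s \<theta> n)" using n subspace_0[OF K] by (intro \<Gamma>_I[of _ n _ 0]) simp_all
    moreover have "v + (y - 1) *s \<theta> n \<in> socle scale UNIV (plus_multiples K (x * y))"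
      unfolding socle_def plus_multiples_def
    proof (simp, intro ballI)
      fix r :: 'a assume "r \<in> max_ideal"
      then obtain q where q: "r *s v - x *s q \<in> K" using v by blast
      then have "(r *s v - x *s q) + (y - 1) *s (r *s \<theta> n - x *s q) \<in> K"
        using \<theta>_rep[OF n KW] by (intro subspace_add[OF K] subspace_scale[OF K])
      also have "(r *s v - x *s q) + (y - 1) *s (r *s \<theta> n - x *s q)
          = r *s (v + (y - 1) *s \<theta> n) - (x * y) *s q"
        by (simp add: algebra_simps)
      finally show "\<exists>q. r *s (v + (y - 1) *s \<theta> n) - (x * y) *s q \<in> K" by blast
    qed
    ultimately show "\<exists>v'\<in>socle scale UNIV (plus_multiples K (x * y)). \<Gamma> v v'" by blast
  next
    fix v' assume "v' \<in> socle scale UNIV (plus_multiples K (x * y))"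
    then have v': "\<And>r. r \<in> max_ideal \<Longrightarrow> \<exists>q. r *s v' - (x * y) *s q \<in> K"
      by (auto simp: socle_def plus_multiples_def)
    then obtain n where n: "\<And>u. u \<in> max_ideal \<Longrightarrow> u *s v' - (x * y) *s n u \<in> K" by metis
    have "\<theta> (\<lambda>u. (x * y) *s n u) - \<theta> (\<lambda>u. u *s v') \<in> W"
    proof (rule \<theta>_diff[OF W])
      fix u w assume "(u, w) \<in> set l"
      then have "(- w) *s (u *s v' - (x * y) *s n u) \<in> W"
        using n u_max KW by (blast intro: subspace_scale[OF W])
      then show "w *s ((x * y) *s n u - u *s v') \<in> W" by (simp add: algebra_simps)
    qed
    then have "x *s (y *s \<theta> n - v') \<in> W" by (simp add: \<theta>_scale \<theta>_mult scale_right_diff_distrib)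
    then have diff: "y *s \<theta> n - v' \<in> W" by (rule W_x)
    \<comment> \<open>The inverse map. Here \<open>n\<close> comes from dividing by
      \<open>x * y\<close>, so \<open>\<theta> n\<close> stands for \<open>v' / y\<close> modulo
      \<open>W\<close>, and \<open>v\<close> is \<open>(v' - y \<theta> n) + \<theta> n\<close>.
      Consequently \<open>y v\<close> agrees with \<open>v'\<close> modulo \<open>W\<close>.\<close>
    define v where "v = v' + (1 - y) *s \<theta> n"
    have vW: "r *s v - x *s q \<in> W" if "r *s v' - (x * y) *s q \<in> K" for r q
    proof (rule W_y)
      have "(r *s v' - (x * y) *s q) + (r * (1 - y)) *s (y *s \<theta> n - v') \<in> W"
        using diff KW[OF that] by (intro subspace_add[OF W] subspace_scale[OF W])
      also have "(r *s v' - (x * y) *s q) + (r * (1 - y)) *s (y *s \<theta> n - v') = y *s (r *s v - x *s q)"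
        by (simp add: v_def algebra_simps)
      finally show "y *s (r *s v - x *s q) \<in> W" .
    qed
    have lifts: "lifts v n" using vW n u_max by (auto simp: lifts_def)
    have "v' - (v + (y - 1) *s \<theta> n) - (x * y) *s 0 = 0" by (simp add: v_def algebra_simps)
    then have "\<Gamma> v v'" using lifts subspace_0[OF K] by (intro \<Gamma>_I[of _ n _ 0]) simp_all
    moreover have "v \<in> socle scale UNIV (plus_multiples K x)"
      unfolding socle_def plus_multiples_def
    proof (simp, intro ballI)
      fix r :: 'a assume "r \<in> max_ideal"
      then obtain q where q: "r *s v' - (x * y) *s q \<in> K" using v' by blast
      then have "(r *s v' - (x * y) *s q) + (1 - y) *s (r *s \<theta> n - x *s q) \<in> K"
        using \<theta>_rep[OF lifts vW] by (intro subspace_add[OF K] subspace_scale[OF K])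
      also have "(r *s v' - (x * y) *s q) + (1 - y) *s (r *s \<theta> n - x *s q) = r *s v - x *s q"
        by (simp add: v_def algebra_simps)
      finally show "\<exists>q. r *s v - x *s q \<in> K" by blast
    qed
    ultimately show "\<exists>v\<in>socle scale UNIV (plus_multiples K x). \<Gamma> v v'" by blast
  next
    fix v v' assume "\<Gamma> v v'"
    then obtain n q where n: "lifts v n" and q: "v' - (v + (y - 1) *s \<theta> n) - (x * y) *s q \<in> K"
      unfolding \<Gamma>_def by blast
    show "v \<in> plus_multiples K x \<longleftrightarrow> v' \<in> plus_multiples K (x * y)"
    proof
      assume "v \<in> plus_multiples K x"
      then obtain e where e: "v - x *s e \<in> K" by (auto simp: plus_multiples_def)
      then have "1 *s \<theta> n - x *s e \<in> K" using KW by (intro \<theta>_rep[OF n]) simp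
      then have "(v' - (v + (y - 1) *s \<theta> n) - (x * y) *s q)
          + ((v - x *s e) + (y - 1) *s (1 *s \<theta> n - x *s e)) \<in> K"
        using q e by (intro subspace_add[OF K] subspace_scale[OF K])
      also have "(v' - (v + (y - 1) *s \<theta> n) - (x * y) *s q)
          + ((v - x *s e) + (y - 1) *s (1 *s \<theta> n - x *s e)) = v' - (x * y) *s (q + e)"
        by (simp add: algebra_simps)
      finally show "v' \<in> plus_multiples K (x * y)" by (auto simp: plus_multiples_def)
    next
      assume "v' \<in> plus_multiples K (x * y)"
      then obtain e where e: "v' - (x * y) *s e \<in> K" by (auto simp: plus_multiples_def)
      have "(v' - (x * y) *s e) - (v' - (v + (y - 1) *s \<theta> n) - (x * y) *s q) \<in> K"
        by (rule subspace_diff[OF K e q])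
      also have "(v' - (x * y) *s e) - (v' - (v + (y - 1) *s \<theta> n) - (x * y) *s q)
          = v + (y - 1) *s \<theta> n - (x * y) *s (e - q)" by (simp add: algebra_simps)
      finally have vK: "v + (y - 1) *s \<theta> n - (x * y) *s (e - q) \<in> K" .
      \<comment> \<open>Modulo \<open>W\<close> the element in \<open>vK\<close> is
        \<open>y v - x y (e - q)\<close>. Cancelling \<open>y\<close> makes
        \<open>\<theta>_rep\<close> applicable, which trades \<open>\<theta> n\<close> for a
        multiple of \<open>x\<close> modulo \<open>K\<close>.\<close>
      have "(v + (y - 1) *s \<theta> n - (x * y) *s (e - q)) - (y - 1) *s (\<theta> n - v) \<in> W"
        by (rule subspace_diff[OF W KW[OF vK] subspace_scale[OF W \<theta>_proj[OF n]]])
      also have "(v + (y - 1) *s \<theta> n - (x * y) *s (e - q)) - (y - 1) *s (\<theta> n - v)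
          = y *s (1 *s v - x *s (e - q))" by (simp add: algebra_simps)
      finally have "1 *s \<theta> n - x *s (e - q) \<in> K" by (rule \<theta>_rep[OF n W_y])
      then have "(v + (y - 1) *s \<theta> n - (x * y) *s (e - q)) - (y - 1) *s (1 *s \<theta> n - x *s (e - q)) \<in> K"
        by (rule subspace_diff[OF K vK subspace_scale[OF K]])
      also have "(v + (y - 1) *s \<theta> n - (x * y) *s (e - q)) - (y - 1) *s (1 *s \<theta> n - x *s (e - q))
          = v - x *s (e - q)" by (simp add: algebra_simps)
      finally show "v \<in> plus_multiples K x" by (auto simp: plus_multiples_def)
    qed
  qed
  show ?thesis by (rule k_dim_eq[OF one])
qed

end

section \<open>Exchange in systems of parameters and the common sequence\<close>

context local_noetherian_module
begin

lemma one_notin_max_ideal: "1 \<notin> (max_ideal :: 'a set)"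
  by (rule prime_ideal_one[OF prime_max_ideal[OF local_ring]])

lemma ir_alt: "ir scale xs = k_dim scale (socle scale UNIV (smult_span (set xs))) (smult_span (set xs))"
  by (simp add: ir_def quot_bot_zero)

lemma is_ideal_bideal: "is_ideal (bideal scale UNIV (smult_span X))"
  unfolding bideal_def quot_bot_smult_span
  by (rule is_ideal_Inter) (use is_ideal_ann[OF subspace_smult_span] in blast)

text \<open>Elements of \<open>X\<close> act as zero modulo \<open>smult_span X\<close>. This is
  what confines the primes that contain a \<open>bideal\<close>.\<close>

lemma subset_bideal: "X \<subseteq> bideal scale UNIV (smult_span X)"
  unfolding bideal_def quot_bot_smult_span
  using smult_in_smult_span by (auto simp: ann_def)

lemma bideal_kills:
  assumes "sop scale UNIV (smult_span X) (zs @ [u])" "c \<in> bideal scale UNIV (smult_span X)"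
    and "u *s v \<in> smult_span (X \<union> set zs)"
  shows "c *s v \<in> smult_span (X \<union> set zs)"
proof -
  let ?zs = "zs @ [u]"
  have "\<exists>zs' i. ann scale (colon scale UNIV (quot_bot scale (take (length zs) ?zs) UNIV (smult_span X)) (?zs ! length zs))
      (quot_bot scale (take (length zs) ?zs) UNIV (smult_span X))
    = ann scale (colon scale UNIV (quot_bot scale (take i zs') UNIV (smult_span X)) (zs' ! i))
      (quot_bot scale (take i zs') UNIV (smult_span X)) \<and> sop scale UNIV (smult_span X) zs' \<and> i < length zs'"
    using assms(1) by (intro exI[of _ ?zs] exI[of _ "length zs"]) simp
  then have "c \<in> ann scale (colon scale UNIV (quot_bot scale (take (length zs) ?zs) UNIV (smult_span X)) (?zs ! length zs))
      (quot_bot scale (take (length zs) ?zs) UNIV (smult_span X))"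
    using assms(2) unfolding bideal_def by blast
  then show ?thesis using assms(3) by (simp add: ann_def colon_def quot_bot_smult_span)
qed

lemma ir_exchange_mult:
  assumes dim: "mdim scale UNIV {0} = enat (Suc (length zs + length xs))"
    and max: "set zs \<union> set xs \<subseteq> max_ideal"
    and x: "x \<in> ideal_prod max_ideal (bideal scale UNIV (smult_span (set xs)))"
    and y: "y \<in> max_ideal"
    and supp: "supported_at_max (insert x (set zs \<union> set xs))" "supported_at_max (insert y (set zs \<union> set xs))"
  shows "ir scale (zs @ x # xs) = ir scale (zs @ (x * y) # xs)"
proof -
  note m = is_ideal_max_ideal[OF local_ring]
  let ?b = "bideal scale UNIV (smult_span (set xs))"
  obtain l where l: "set l \<subseteq> max_ideal \<times> ?b" "x = (\<Sum>(u, w)\<leftarrow>l. u * w)"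
    using ideal_prod_sum_list[OF m x] by blast
  have kills: "c *s v \<in> smult_span (set xs \<union> set zs)"
    if c: "c \<in> ?b" and v: "(x * y) ^ n *s v \<in> smult_span (set xs \<union> set zs)" for c n v
  proof (rule bideal_kills[OF _ c])
    \<comment> \<open>The exponent is raised by one because for \<open>n = 0\<close> the power would
      be 1, which is not a parameter.\<close>
    have "(x * y) ^ Suc n \<in> max_ideal" using is_ideal_mult_right[OF m is_ideal_mult[OF m y]] by simp
    moreover have "supported_at_max (set (zs @ [(x * y) ^ Suc n]) \<union> set xs)"
      unfolding supported_at_max_def
    proof (intro allI impI)
      fix p assume p: "prime_ideal p" "ann scale UNIV {0} \<union> (set (zs @ [(x * y) ^ Suc n]) \<union> set xs) \<subseteq> p"
      then have "(x * y) ^ Suc n \<in> p" by simp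
      then have "x \<in> p \<or> y \<in> p" using prime_ideal_power[OF p(1)] prime_ideal_mult_iff[OF p(1)] by blast
      then show "p = max_ideal" using supp p by (auto simp: supported_at_max_def)
    qed
    ultimately show "sop scale UNIV (smult_span (set xs)) (zs @ [(x * y) ^ Suc n])"
      using dim max by (intro sopI) auto
    have "(x * y) *s ((x * y) ^ n *s v) \<in> smult_span (set xs \<union> set zs)"
      using v by (rule subspace_scale[OF subspace_smult_span])
    then show "(x * y) ^ Suc n *s v \<in> smult_span (set xs \<union> set zs)" by simp
  qed
  have set_eq: "set (zs @ w # xs) = insert w (set xs \<union> set zs)" for w by auto
  show ?thesis
    unfolding ir_alt set_eq smult_span_insert_plus_multiples
    by (rule socle_dim_mult[OF subspace_smult_span one_notin_max_ideal l kills])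
qed

lemma ir_exchange:
  assumes dim: "mdim scale UNIV {0} = enat (Suc (length zs + length xs))"
    and max: "set zs \<union> set xs \<subseteq> max_ideal"
    and xy: "x \<in> ideal_prod max_ideal (bideal scale UNIV (smult_span (set xs)))"
      "y \<in> ideal_prod max_ideal (bideal scale UNIV (smult_span (set xs)))"
    and supp: "supported_at_max (insert x (set zs \<union> set xs))" "supported_at_max (insert y (set zs \<union> set xs))"
  shows "ir scale (zs @ x # xs) = ir scale (zs @ y # xs)"
proof -
  have "x \<in> max_ideal" "y \<in> max_ideal"
    using xy ideal_prod_subset_left[OF is_ideal_max_ideal[OF local_ring]] by blast+
  then show ?thesis
    using ir_exchange_mult[OF dim max xy(1) _ supp] ir_exchange_mult[OF dim max xy(2) _ supp(2,1)]
    by (simp add: mult.commute)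
qed

text \<open>Prime avoidance in \<open>I \<inter> J\<close>, for finitely many non-maximal primes
  covering the supports modulo \<open>Z \<union> X\<close> and modulo \<open>Z \<union> Y\<close>.
  Avoiding these is enough because one more element, \<open>x\<close> or \<open>y\<close>, already
  leaves only the maximal ideal, so both quotients have dimension at most one.\<close>

lemma common_parameter:
  assumes I: "is_ideal I" and J: "is_ideal J" and "x \<in> max_ideal" "y \<in> max_ideal"
    and supp: "supported_at_max (insert x (Z \<union> X))" "supported_at_max (insert y (Z \<union> Y))"
    and I_p: "\<And>p. prime_ideal p \<Longrightarrow> I \<subseteq> p \<Longrightarrow> p = max_ideal \<or> insert x X \<subseteq> p"
    and J_p: "\<And>p. prime_ideal p \<Longrightarrow> J \<subseteq> p \<Longrightarrow> p = max_ideal \<or> insert y Y \<subseteq> p"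
  shows "\<exists>z\<in>I \<inter> J. supported_at_max (insert z (Z \<union> X)) \<and> supported_at_max (insert z (Z \<union> Y))"
proof -
  note prime_m = prime_max_ideal[OF local_ring]
  obtain S where S: "finite S" "\<And>p. p \<in> S \<Longrightarrow> prime_ideal p \<and> ideal_gen (ann scale UNIV {0} \<union> (Z \<union> X)) \<subseteq> p"
    "\<And>q. prime_ideal q \<Longrightarrow> ideal_gen (ann scale UNIV {0} \<union> (Z \<union> X)) \<subseteq> q \<Longrightarrow> \<exists>p\<in>S. p \<subseteq> q"
    using finite_primes_below[OF noetherian is_ideal_ideal_gen] by metis
  obtain T where T: "finite T" "\<And>p. p \<in> T \<Longrightarrow> prime_ideal p \<and> ideal_gen (ann scale UNIV {0} \<union> (Z \<union> Y)) \<subseteq> p"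
    "\<And>q. prime_ideal q \<Longrightarrow> ideal_gen (ann scale UNIV {0} \<union> (Z \<union> Y)) \<subseteq> q \<Longrightarrow> \<exists>p\<in>T. p \<subseteq> q"
    using finite_primes_below[OF noetherian is_ideal_ideal_gen] by metis
  have AZ: "ann scale UNIV {0} \<union> Z \<subseteq> p" if "p \<in> S \<union> T" for p
    using that S(2) T(2) ideal_gen_superset[of "ann scale UNIV {0} \<union> (Z \<union> X)"]
      ideal_gen_superset[of "ann scale UNIV {0} \<union> (Z \<union> Y)"] by blast
  have "\<exists>z\<in>I \<inter> J. \<forall>p\<in>S \<union> T - {max_ideal}. z \<notin> p"
  proof (rule prime_avoidance)
    fix p assume p: "p \<in> S \<union> T - {max_ideal}"
    then have pp: "prime_ideal p" using S(2) T(2) by blast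
    have "\<not> I \<inter> J \<subseteq> p"
    proof
      assume "I \<inter> J \<subseteq> p"
      \<comment> \<open>Either alternative contradicts a support hypothesis, whichever of
        \<open>S\<close> and \<open>T\<close> the prime \<open>p\<close> came from, since it
        contains the annihilator and \<open>Z\<close> in both cases.\<close>
      then have "insert x X \<subseteq> p \<or> insert y Y \<subseteq> p"
        using prime_ideal_Int_subset[OF pp I J] I_p[OF pp] J_p[OF pp] p by blast
      then show False using supp pp p AZ[of p] unfolding supported_at_max_def by blast
    qed
    with pp show "prime_ideal p \<and> \<not> I \<inter> J \<subseteq> p" ..
  qed (use S(1) T(1) is_ideal_Int[OF I J] in auto)
  then obtain z where z: "z \<in> I \<inter> J" "\<And>p. p \<in> S \<union> T \<Longrightarrow> p \<noteq> max_ideal \<Longrightarrow> z \<notin> p" by blast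
  have "supported_at_max (insert z (Z \<union> E))"
    if supp_e: "supported_at_max (insert e (Z \<union> E))" and e: "e \<in> max_ideal"
      and Q: "\<And>p. p \<in> Q \<Longrightarrow> prime_ideal p \<and> ideal_gen (ann scale UNIV {0} \<union> (Z \<union> E)) \<subseteq> p"
        "\<And>q. prime_ideal q \<Longrightarrow> ideal_gen (ann scale UNIV {0} \<union> (Z \<union> E)) \<subseteq> q \<Longrightarrow> \<exists>p\<in>Q. p \<subseteq> q"
        "Q \<subseteq> S \<union> T"
    for e E Q
    unfolding supported_at_max_def
  proof (intro allI impI, rule ccontr)
    fix q assume q: "prime_ideal q" "ann scale UNIV {0} \<union> insert z (Z \<union> E) \<subseteq> q" "q \<noteq> max_ideal"
    then have qm: "q \<subset> max_ideal" using prime_subset_max_ideal[OF local_ring] by blast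
    have "ideal_gen (ann scale UNIV {0} \<union> (Z \<union> E)) \<subseteq> q"
      using q by (intro ideal_gen_least prime_ideal_is_ideal) auto
    then obtain p where p: "p \<in> Q" "p \<subseteq> q" using Q(2) q(1) by blast
    then have "z \<notin> p" using z(2)[of p] qm Q(3) by blast
    \<comment> \<open>This makes a chain of length two ending in \<open>max_ideal\<close> over
      \<open>Z \<union> E\<close>. The principal ideal theorem then finds a smaller prime containing
      \<open>e\<close>, against the hypothesis on \<open>e\<close>.\<close>
    then have "p \<subset> q" using p q(2) by blast
    then obtain p' where p': "prime_ideal p'" "p \<subseteq> p'" "e \<in> p'" "p' \<subset> max_ideal"
      using krull_principal_ideal[OF noetherian _ q(1) prime_m _ qm e] Q(1)[OF p(1)] by blast
    have "ann scale UNIV {0} \<union> (Z \<union> E) \<subseteq> p"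
      using Q(1)[OF p(1)] ideal_gen_superset by (meson order_trans)
    then have "ann scale UNIV {0} \<union> insert e (Z \<union> E) \<subseteq> p'" using p' by blast
    then have "p' = max_ideal" using supp_e p'(1) unfolding supported_at_max_def by blast
    then show False using p'(4) by blast
  qed
  from this[OF supp(1) _ S(2,3)] this[OF supp(2) _ T(2,3)] show ?thesis
    using z(1) assms(3,4) by blast
qed

text \<open>A proper \<open>b\<close> lies in the maximal ideal, and then its cube lies in the
  product. If \<open>b\<close> is the whole ring, every parameter lies in the product because it
  lies in the maximal ideal.\<close>

lemma C_sop_nth:
  assumes xs: "C_sop scale xs" and i: "i < length xs"
  shows "xs ! i \<in> ideal_prod max_ideal (bideal scale UNIV (smult_span (set (drop (Suc i) xs))))"
proof -
  note m = is_ideal_max_ideal[OF local_ring]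
  define b where "b = bideal scale UNIV (smult_span (set (drop (Suc i) xs)))"
  have b: "is_ideal b" unfolding b_def by (rule is_ideal_bideal)
  have x3: "xs ! i \<in> ideal_pow b 3"
    using xs i by (simp add: C_sop_def quot_bot_zero b_def)
  have xm: "xs ! i \<in> max_ideal" using xs i by (auto simp: C_sop_def sop_def)
  have "xs ! i \<in> ideal_prod max_ideal b"
  proof (cases "b = UNIV")
    case True
    then show ?thesis using mult_in_ideal_prod[OF xm, of 1 b] by simp
  next
    case False
    then have bm: "b \<subseteq> max_ideal" by (rule ideal_subset_max_ideal[OF local_ring b])
    have "xs ! i \<in> ideal_prod b (ideal_prod b (ideal_prod b UNIV))"
      using x3 by (simp add: numeral_3_eq_3)
    also have "\<dots> \<subseteq> ideal_prod max_ideal b"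
      unfolding ideal_prod_def[of b "ideal_prod b (ideal_prod b UNIV)"]
      using bm ideal_prod_subset_left[OF b, of "ideal_prod b UNIV"]
      by (intro ideal_gen_least is_ideal_ideal_prod) (auto intro!: mult_in_ideal_prod)
    finally show ?thesis .
  qed
  then show ?thesis by (simp add: b_def)
qed

text \<open>A prime over a product contains one of the factors; this verifies the assumptions
  \<open>I_p\<close> and \<open>J_p\<close> of \<open>common_parameter\<close>.\<close>

lemma prime_contains_bideal_prod:
  assumes "x \<in> ideal_prod max_ideal (bideal scale UNIV (smult_span X))"
    and p: "prime_ideal p" "ideal_prod max_ideal (bideal scale UNIV (smult_span X)) \<subseteq> p"
  shows "p = max_ideal \<or> insert x X \<subseteq> p"
  using prime_ideal_ideal_prod_subset[OF p]
proof
  assume "max_ideal \<subseteq> p"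
  then show ?thesis using prime_subset_max_ideal[OF local_ring p(1)] by simp
next
  assume "bideal scale UNIV (smult_span X) \<subseteq> p"
  then have "X \<subseteq> p" using subset_bideal by (rule order_trans[rotated])
  moreover have "x \<in> p" using assms(1) p(2) by (rule subsetD[rotated])
  ultimately show ?thesis by simp
qed

text \<open>Induction on the number of replaced entries. Replacing entry \<open>i\<close> keeps the
  tails after it, so the two \<open>bideal\<close>s are still those of the given C-systems, and one
  \<open>z\<close> is taken from both products. The support clauses keep the mixed sequences systems
  of parameters, as the exchange requires.\<close>

lemma common_initial_segment:
  assumes dim: "mdim scale UNIV {0} = enat d" and C: "C_sop scale xs" "C_sop scale ys"
    and len: "length xs = d" "length ys = d" and "i \<le> d"
  shows "\<exists>zs. length zs = i \<and> set zs \<subseteq> max_ideal \<and>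
    supported_at_max (set zs \<union> set (drop i xs)) \<and> supported_at_max (set zs \<union> set (drop i ys)) \<and>
    ir scale (zs @ drop i xs) = ir scale xs \<and> ir scale (zs @ drop i ys) = ir scale ys"
  using \<open>i \<le> d\<close>
proof (induction i)
  case 0
  then show ?case using C sop_supported by (auto simp: C_sop_def)
next
  case (Suc i)
  note m = is_ideal_max_ideal[OF local_ring]
  obtain zs where zs: "length zs = i" "set zs \<subseteq> max_ideal"
    "supported_at_max (set zs \<union> set (drop i xs))" "supported_at_max (set zs \<union> set (drop i ys))"
    "ir scale (zs @ drop i xs) = ir scale xs" "ir scale (zs @ drop i ys) = ir scale ys"
    using Suc by auto
  define P where "P ws = ideal_prod max_ideal (bideal scale UNIV (smult_span (set (drop (Suc i) ws))))" for ws
  have drop_eq: "drop i ws = ws ! i # drop (Suc i) ws" if "length ws = d" for ws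
    using that Suc.prems by (simp add: Cons_nth_drop_Suc)
  have nth_P: "ws ! i \<in> P ws" if "C_sop scale ws" "length ws = d" for ws
    unfolding P_def using C_sop_nth[OF that(1)] that(2) Suc.prems by simp
  have P_max: "P ws \<subseteq> max_ideal" for ws unfolding P_def by (rule ideal_prod_subset_left[OF m])
  have supp: "supported_at_max (insert (ws ! i) (set zs \<union> set (drop (Suc i) ws)))"
    if "length ws = d" "supported_at_max (set zs \<union> set (drop i ws))" for ws
    using that(2) by (simp add: drop_eq[OF that(1)])
  have "\<exists>z\<in>P xs \<inter> P ys. supported_at_max (insert z (set zs \<union> set (drop (Suc i) xs))) \<and>
      supported_at_max (insert z (set zs \<union> set (drop (Suc i) ys)))"
  proof (rule common_parameter)
    show "is_ideal (P xs)" "is_ideal (P ys)" by (simp_all add: P_def is_ideal_ideal_prod)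
    show "xs ! i \<in> max_ideal" "ys ! i \<in> max_ideal" using nth_P C len P_max by blast+
    show "supported_at_max (insert (xs ! i) (set zs \<union> set (drop (Suc i) xs)))"
      by (rule supp[OF len(1) zs(3)])
    show "supported_at_max (insert (ys ! i) (set zs \<union> set (drop (Suc i) ys)))"
      by (rule supp[OF len(2) zs(4)])
  next
    fix p :: "'a set" assume p: "prime_ideal p"
    show "p = max_ideal \<or> insert (xs ! i) (set (drop (Suc i) xs)) \<subseteq> p" if "P xs \<subseteq> p"
      by (rule prime_contains_bideal_prod[OF nth_P[OF C(1) len(1), unfolded P_def] p that[unfolded P_def]])
    show "p = max_ideal \<or> insert (ys ! i) (set (drop (Suc i) ys)) \<subseteq> p" if "P ys \<subseteq> p"
      by (rule prime_contains_bideal_prod[OF nth_P[OF C(2) len(2), unfolded P_def] p that[unfolded P_def]])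
  qed
  then obtain z where z: "z \<in> P xs" "z \<in> P ys"
    "supported_at_max (insert z (set zs \<union> set (drop (Suc i) xs)))"
    "supported_at_max (insert z (set zs \<union> set (drop (Suc i) ys)))" by blast
  have ir_z: "ir scale ((zs @ [z]) @ drop (Suc i) ws) = ir scale (zs @ drop i ws)"
    if ws: "C_sop scale ws" "length ws = d" and "z \<in> P ws"
      and supp_w: "supported_at_max (set zs \<union> set (drop i ws))"
      and supp_z: "supported_at_max (insert z (set zs \<union> set (drop (Suc i) ws)))" for ws
  proof -
    have "set ws \<subseteq> max_ideal" using ws(1) by (simp add: C_sop_def sop_def)
    then have "set zs \<union> set (drop (Suc i) ws) \<subseteq> max_ideal"
      using zs(2) set_drop_subset[of "Suc i" ws] by blast
    moreover have "mdim scale UNIV {0} = enat (Suc (length zs + length (drop (Suc i) ws)))"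
      using dim zs(1) ws(2) Suc.prems by simp
    ultimately have "ir scale (zs @ z # drop (Suc i) ws) = ir scale (zs @ ws ! i # drop (Suc i) ws)"
      using \<open>z \<in> P ws\<close> nth_P[OF ws] supp_z supp[OF ws(2) supp_w]
      unfolding P_def by (intro ir_exchange)
    then show ?thesis by (simp add: drop_eq[OF ws(2)])
  qed
  have "ir scale ((zs @ [z]) @ drop (Suc i) xs) = ir scale xs"
    using ir_z[OF C(1) len(1) z(1) zs(3) z(3)] zs(5) by simp
  moreover have "ir scale ((zs @ [z]) @ drop (Suc i) ys) = ir scale ys"
    using ir_z[OF C(2) len(2) z(2) zs(4) z(4)] zs(6) by simp
  moreover have "z \<in> max_ideal" using z(1) P_max by blast
  ultimately show ?case using zs(1,2) z(3,4) by (intro exI[of _ "zs @ [z]"]) simp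
qed

end

theorem theorem3p2:
  fixes s :: "'a::comm_ring_1 \<Rightarrow> 'm::ab_group_add \<Rightarrow> 'm"
    and h :: "'b::comm_ring_1 \<Rightarrow> 'a"
    and d :: nat and xs ys :: "'a list"
  assumes "noetherian_local_ring TYPE('a)"
    and "cohen_macaulay_local_ring TYPE('b)" and "ring_hom h" and "surj h"
    and "module s" and "finitely_generated s"
    and "mdim s UNIV {0} = enat d" and "d > 0"
    and "C_sop s xs" and "C_sop s ys"
  shows "ir s xs = ir s ys"
proof -
  interpret local_noetherian_module s
    using assms(1,5,6)
    by (simp add: local_noetherian_module_def local_noetherian_module_axioms_def
        noetherian_module_def noetherian_module_axioms_def noetherian_local_ring_def)
  have len: "length xs = d" "length ys = d"
    using assms(7,9,10) by (simp_all add: C_sop_def sop_def)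
  then show ?thesis
    \<comment> \<open>For \<open>i = d\<close> both tails are empty and both indices are that of the
      same \<open>zs\<close>.\<close>
    using common_initial_segment[OF assms(7,9,10) len order_refl] by auto
qed

end
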